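(* Let $H\le F$ be a non-trivial finitely generated subgroup. Then, with respect to the uniform measure $\mathfrak m$ on $\partial F$, either (i) $H$ is of finite index in $F$ and its action on $(\partial F,\mathfrak m)$ is ergodic (therefore, conservative), or (ii) $H$ is of infinite index in $F$ and its action on $(\partial F,\mathfrak m)$ is completely dissipative.
   Context: $F$ is the free group freely generated by a finite set $\mathcal A$ with $|\mathcal A|=m\ge 2$; elements $g\in F$ are identified with finite freely reduced words in $\mathcal A\sqcup\mathcal A^{-1}$, $|g|$ is the length. $\partial F$ is the set of infinite freely reduced words with the product topology; $F$ acts on it by concatenation followed by free reduction. The uniform measure $\mathfrak m$ is the Borel probability measure on $\partial F$ for which the set of infinite words beginning with $g$ has measure $\frac1{2m(2m-1)^{|g|-1}}$ for every $g\ne e$; it is quasi-invariant under $F$. For a measure class preserving action of a countable group $G$ on a measure space $(\mathcal X,\mu)$: a measurable set $A$ is recurrent if (mod 0) $A\subset\bigcup_{g\ne e}gA$, and wandering if its translates $gA$, $g\in G$, are pairwise disjoint. The action is conservative if every measurable set of positive measure is recurrent; it is completely dissipative if $\mathcal X$ is (mod 0) the union of the translates of a wandering set; it is ergodic if every invariant measurable set is null or conull. *)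

theory Defs
  imports "HOL-Algebra.Generated_Groups" "HOL-Algebra.Coset" "HOL-Probability.Probability"
begin

section \<open>The free group on a set\<close>

text \<open>A letter is a generator with a sign: \<open>(a, True)\<close> stands for \<open>a\<close> and
  \<open>(a, False)\<close> for its formal inverse.\<close>

type_synonym 'a letter = "'a \<times> bool"

definition letters :: "'a set \<Rightarrow> 'a letter set" where
  "letters A = A \<times> UNIV"

definition inv_letter :: "'a letter \<Rightarrow> 'a letter" where
  "inv_letter x = (fst x, \<not> snd x)"

definition reduced :: "'a letter list \<Rightarrow> bool" where
  "reduced w \<longleftrightarrow> (\<forall>i. Suc i < length w \<longrightarrow> w ! Suc i \<noteq> inv_letter (w ! i))"

text \<open>Put a letter in front of a reduced word and cancel if possible; at most one cancellation
  can occur. Iterating this from the right computes the free reduction of a word.\<close>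

fun cons_red :: "'a letter \<Rightarrow> 'a letter list \<Rightarrow> 'a letter list" where
  "cons_red x [] = [x]"
| "cons_red x (y # w) = (if y = inv_letter x then w else x # y # w)"

definition free_reduce :: "'a letter list \<Rightarrow> 'a letter list" where
  "free_reduce w = foldr cons_red w []"

definition free_group :: "'a set \<Rightarrow> 'a letter list monoid" where
  "free_group A =
     \<lparr>carrier = {w. set w \<subseteq> letters A \<and> reduced w},
      monoid.mult = (\<lambda>u v. free_reduce (u @ v)),
      one = []\<rparr>"

definition finitely_generated_subgroup :: "'g set \<Rightarrow> ('g, 'b) monoid_scheme \<Rightarrow> bool" where
  "finitely_generated_subgroup H G \<longleftrightarrow>
     subgroup H G \<and> (\<exists>S. finite S \<and> S \<subseteq> carrier G \<and> H = generate G S)"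

section \<open>The boundary and the uniform measure\<close>

definition boundary :: "'a set \<Rightarrow> (nat \<Rightarrow> 'a letter) set" where
  "boundary A = {\<omega>. (\<forall>i. \<omega> i \<in> letters A) \<and> (\<forall>i. \<omega> (Suc i) \<noteq> inv_letter (\<omega> i))}"

definition boundary_topology :: "'a set \<Rightarrow> (nat \<Rightarrow> 'a letter) topology" where
  "boundary_topology A =
     subtopology (product_topology (\<lambda>_. discrete_topology (letters A)) UNIV) (boundary A)"

text \<open>Concatenation followed by free reduction, as for finite words: the letters of \<open>g\<close> are put
  one after another, starting with the last one, in front of the reduced infinite word.\<close>

definition cons_red_inf :: "'a letter \<Rightarrow> (nat \<Rightarrow> 'a letter) \<Rightarrow> (nat \<Rightarrow> 'a letter)" where
  "cons_red_inf x \<omega> = (if \<omega> 0 = inv_letter x then (\<lambda>i. \<omega> (Suc i)) else case_nat x \<omega>)"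

definition boundary_act :: "'a letter list \<Rightarrow> (nat \<Rightarrow> 'a letter) \<Rightarrow> (nat \<Rightarrow> 'a letter)" where
  "boundary_act g \<omega> = foldr cons_red_inf g \<omega>"

definition cylinder :: "'a set \<Rightarrow> 'a letter list \<Rightarrow> (nat \<Rightarrow> 'a letter) set" where
  "cylinder A g = {\<omega> \<in> boundary A. \<forall>i < length g. \<omega> i = g ! i}"

text \<open>The cylinders together with the empty set form an intersection-stable generator of the
  Borel sets, so at most one measure satisfies this.\<close>

definition is_uniform_measure :: "'a set \<Rightarrow> (nat \<Rightarrow> 'a letter) measure \<Rightarrow> bool" where
  "is_uniform_measure A M \<longleftrightarrow>
     prob_space M \<and>
     space M = boundary A \<and>
     sets M = sigma_sets (boundary A) {U. openin (boundary_topology A) U} \<and>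
     (\<forall>g \<in> carrier (free_group A). g \<noteq> \<one>\<^bsub>free_group A\<^esub> \<longrightarrow>
        measure M (cylinder A g) =
          1 / (2 * real (card A) * (2 * real (card A) - 1) ^ (length g - 1)))"

section \<open>Conservativity, dissipativity and ergodicity\<close>

text \<open>The following notions are meant for a countable group \<open>G\<close> acting by \<open>\<phi>\<close> on the space of
  \<open>M\<close> by measurable transformations preserving the class of null sets.\<close>

definition recurrent_set ::
    "('g, 'b) monoid_scheme \<Rightarrow> ('g \<Rightarrow> 'x \<Rightarrow> 'x) \<Rightarrow> 'x measure \<Rightarrow> 'x set \<Rightarrow> bool" where
  "recurrent_set G \<phi> M B \<longleftrightarrow>
     B \<in> sets M \<and> (AE x in M. x \<in> B \<longrightarrow> x \<in> (\<Union>g \<in> carrier G - {\<one>\<^bsub>G\<^esub>}. \<phi> g ` B))"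

definition wandering_set ::
    "('g, 'b) monoid_scheme \<Rightarrow> ('g \<Rightarrow> 'x \<Rightarrow> 'x) \<Rightarrow> 'x measure \<Rightarrow> 'x set \<Rightarrow> bool" where
  "wandering_set G \<phi> M B \<longleftrightarrow> B \<in> sets M \<and> disjoint_family_on (\<lambda>g. \<phi> g ` B) (carrier G)"

definition conservative_action ::
    "('g, 'b) monoid_scheme \<Rightarrow> ('g \<Rightarrow> 'x \<Rightarrow> 'x) \<Rightarrow> 'x measure \<Rightarrow> bool" where
  "conservative_action G \<phi> M \<longleftrightarrow> (\<forall>B \<in> sets M. emeasure M B > 0 \<longrightarrow> recurrent_set G \<phi> M B)"

definition completely_dissipative_action ::
    "('g, 'b) monoid_scheme \<Rightarrow> ('g \<Rightarrow> 'x \<Rightarrow> 'x) \<Rightarrow> 'x measure \<Rightarrow> bool" where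
  "completely_dissipative_action G \<phi> M \<longleftrightarrow>
     (\<exists>B. wandering_set G \<phi> M B \<and> (AE x in M. x \<in> (\<Union>g \<in> carrier G. \<phi> g ` B)))"

definition ergodic_action ::
    "('g, 'b) monoid_scheme \<Rightarrow> ('g \<Rightarrow> 'x \<Rightarrow> 'x) \<Rightarrow> 'x measure \<Rightarrow> bool" where
  "ergodic_action G \<phi> M \<longleftrightarrow>
     (\<forall>B \<in> sets M. (\<forall>g \<in> carrier G. \<phi> g ` B = B) \<longrightarrow>
        B \<in> null_sets M \<or> space M - B \<in> null_sets M)"

end

theory Submission imports Defs begin

text \<open>Let \<open>q = 2 m - 1\<close>, so that prepending a letter without cancellation divides the measure
  by \<open>q\<close>.

  If \<open>H\<close> has infinite index, let \<open>T\<close> be the union of the \<open>H\<close>-translates of the paths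
  from \<open>e\<close> to the generators. It is an \<open>H\<close>-invariant subtree of the Cayley tree with finite
  quotient, and it is not the whole tree, so below each vertex it misses a cylinder of a fixed relative
  size. Hence almost every ray leaves \<open>T\<close>. The vertex at which a ray leaves \<open>T\<close> depends
  equivariantly on the ray, and \<open>H\<close> acts freely on the vertices, so the rays leaving \<open>T\<close> in a
  transversal of \<open>H\<close> form a wandering set whose translates cover almost everything.

  If \<open>H\<close> has finite index and \<open>B\<close> is invariant, let \<open>\<phi>(g, x)\<close> be the measure of the part of
  \<open>g\<^sup>-\<^sup>1B\<close> in the cylinder of the letter \<open>x\<close>. This is a harmonic function on the finite set
  \<open>H\<setminus>F \<times> letters\<close>, hence constant. So \<open>B\<close> has the same density in all
  cylinders, and then in its own complement.\<close>

section \<open>Reduced words\<close>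

lemma inv_letter_inv_letter [simp]: "inv_letter (inv_letter x) = x"
  by (simp add: inv_letter_def)

lemma inv_letter_neq [simp]: "inv_letter x \<noteq> x" "x \<noteq> inv_letter x"
  by (auto simp: inv_letter_def prod_eq_iff)

lemma inv_letter_eq_iff [simp]: "inv_letter x = inv_letter y \<longleftrightarrow> x = y"
  by (metis inv_letter_inv_letter)

lemma inv_letter_in_letters_iff [simp]: "inv_letter x \<in> letters A \<longleftrightarrow> x \<in> letters A"
  by (simp add: inv_letter_def letters_def mem_Times_iff)

lemma reduced_Nil [simp]: "reduced []"
  by (simp add: reduced_def)

lemma reduced_Cons: "reduced (x # w) \<longleftrightarrow> reduced w \<and> (w \<noteq> [] \<longrightarrow> hd w \<noteq> inv_letter x)"
  unfolding reduced_def by (cases w) (auto simp: nth_Cons split: nat.splits)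

lemma reduced_append:
  "reduced (u @ v) \<longleftrightarrow>
     reduced u \<and> reduced v \<and> (u \<noteq> [] \<longrightarrow> v \<noteq> [] \<longrightarrow> hd v \<noteq> inv_letter (last u))"
  by (induction u) (auto simp: reduced_Cons)

lemma reduced_replicate: "reduced (replicate n x)"
  by (induction n) (auto simp: reduced_Cons)

lemma reduced_cons_red: "reduced w \<Longrightarrow> reduced (cons_red x w)"
  by (cases w) (auto simp: reduced_Cons)

lemma cons_red_eq_Cons: "reduced (x # w) \<Longrightarrow> cons_red x w = x # w"
  by (cases w) (auto simp: reduced_Cons)

lemma cons_red_cancel: "reduced w \<Longrightarrow> cons_red (inv_letter x) (cons_red x w) = w"
  by (cases w) (auto simp: reduced_Cons cons_red_eq_Cons)

lemma cons_red_cancel': "reduced w \<Longrightarrow> cons_red x (cons_red (inv_letter x) w) = w"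
  using cons_red_cancel[of w "inv_letter x"] by simp

lemma reduced_foldr_cons_red: "reduced v \<Longrightarrow> reduced (foldr cons_red u v)"
  by (induction u) (auto intro: reduced_cons_red)

lemma foldr_cons_red_eq_append: "reduced (u @ v) \<Longrightarrow> foldr cons_red u v = u @ v"
  by (induction u) (auto simp: cons_red_eq_Cons reduced_Cons)

text \<open>Van der Waerden's trick: by \<open>cons_red_cancel\<close> each letter permutes the
  reduced words, and the inverse letter acts by the inverse permutation. Free reduction of the
  acting word therefore does not change its action, and associativity is inherited from composition
  of maps.\<close>

lemma foldr_cons_red_cons_red:
  "reduced w \<Longrightarrow> foldr cons_red (cons_red x u) w = cons_red x (foldr cons_red u w)"
  by (cases u) (auto simp: cons_red_cancel' reduced_foldr_cons_red)

lemma foldr_cons_red_assoc: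
  "reduced w \<Longrightarrow> foldr cons_red (foldr cons_red u v) w = foldr cons_red u (foldr cons_red v w)"
  by (induction u) (auto simp: foldr_cons_red_cons_red)

lemma set_cons_red: "set (cons_red x w) \<subseteq> insert x (set w)"
  by (cases w) auto

lemma set_foldr_cons_red: "set (foldr cons_red u v) \<subseteq> set u \<union> set v"
  using set_cons_red by (induction u) fastforce+

lemma free_reduce_append: "reduced v \<Longrightarrow> free_reduce (u @ v) = foldr cons_red u v"
  using foldr_cons_red_eq_append[of v "[]"] by (simp add: free_reduce_def)

definition inv_word :: "'a letter list \<Rightarrow> 'a letter list" where
  "inv_word w = rev (map inv_letter w)"

lemma reduced_inv_word: "reduced w \<Longrightarrow> reduced (inv_word w)"
  unfolding inv_word_def
  by (induction w) (auto simp: reduced_append reduced_Cons last_rev hd_map)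

lemma foldr_cons_red_inv_word:
  "reduced v \<Longrightarrow> foldr cons_red (inv_word u) (foldr cons_red u v) = v"
  unfolding inv_word_def
  by (induction u) (auto simp: cons_red_cancel reduced_foldr_cons_red)

lemma foldr_cons_red_snoc:
  assumes "reduced g"
  shows "foldr cons_red g [x] =
    (if g \<noteq> [] \<and> last g = inv_letter x then butlast g else g @ [x])"
proof (cases g rule: rev_cases)
  case (snoc g' y)
  then show ?thesis
    using assms foldr_cons_red_eq_append[of g "[x]"] foldr_cons_red_eq_append[of g' "[]"]
    by (auto simp: reduced_append reduced_Cons)
qed simp

section \<open>The free group and its multiplication\<close>

abbreviation words :: "'a set \<Rightarrow> 'a letter list set" where
  "words A \<equiv> carrier (free_group A)"

lemma words_iff: "w \<in> words A \<longleftrightarrow> set w \<subseteq> letters A \<and> reduced w"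
  by (simp add: free_group_def)

lemma words_reduced: "w \<in> words A \<Longrightarrow> reduced w"
  by (simp add: words_iff)

lemma one_words [simp]: "\<one>\<^bsub>free_group A\<^esub> = []"
  by (simp add: free_group_def)

lemma Nil_in_words [simp]: "[] \<in> words A"
  by (simp add: words_iff)

lemma singleton_in_words [simp]: "[x] \<in> words A \<longleftrightarrow> x \<in> letters A"
  by (simp add: words_iff reduced_Cons)

lemma mult_words: "v \<in> words A \<Longrightarrow> u \<otimes>\<^bsub>free_group A\<^esub> v = foldr cons_red u v"
  by (simp add: words_iff) (simp add: free_group_def free_reduce_append)

lemma foldr_in_words: "u \<in> words A \<Longrightarrow> v \<in> words A \<Longrightarrow> foldr cons_red u v \<in> words A"
  using set_foldr_cons_red[of u v] by (auto simp: words_iff reduced_foldr_cons_red)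

lemma inv_word_in_words: "w \<in> words A \<Longrightarrow> inv_word w \<in> words A"
  by (auto simp: words_iff reduced_inv_word) (auto simp: inv_word_def)

lemma group_free_group: "group (free_group A)"
proof (rule groupI)
  show "\<exists>y\<in>words A. y \<otimes>\<^bsub>free_group A\<^esub> x = \<one>\<^bsub>free_group A\<^esub>" if "x \<in> words A" for x
    using that foldr_cons_red_inv_word[of "[]" x] foldr_cons_red_eq_append[of x "[]"]
    by (intro bexI[of _ "inv_word x"]) (auto simp: mult_words inv_word_in_words words_reduced)
qed (auto simp: mult_words foldr_in_words foldr_cons_red_assoc words_reduced)

lemma mult_snoc:
  assumes "g \<in> words A" "x \<in> letters A"
  shows "g \<otimes>\<^bsub>free_group A\<^esub> [x] =
    (if g \<noteq> [] \<and> last g = inv_letter x then butlast g else g @ [x])"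
  using assms by (subst mult_words[of _ A]) (auto simp: foldr_cons_red_snoc words_reduced)

lemma mult_eq_append: "u @ v \<in> words A \<Longrightarrow> u \<otimes>\<^bsub>free_group A\<^esub> v = u @ v"
  by (subst mult_words[of _ A]) (auto simp: words_iff reduced_append foldr_cons_red_eq_append)

lemma append_in_words1: "u @ v \<in> words A \<Longrightarrow> u \<in> words A"
  and append_in_words2: "u @ v \<in> words A \<Longrightarrow> v \<in> words A"
  by (auto simp: words_iff reduced_append)

lemma take_in_words: "w \<in> words A \<Longrightarrow> take n w \<in> words A"
  using append_in_words1[of "take n w" "drop n w"] by simp

lemma append_replicate_in_words:
  assumes "w \<in> words A" "w \<noteq> []"
  shows "w @ replicate n (last w) \<in> words A"
  using assms by (auto simp: words_iff reduced_append reduced_replicate)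

lemma mult_Nil [simp]:
  "g \<in> words A \<Longrightarrow> g \<otimes>\<^bsub>free_group A\<^esub> [] = g"
  "g \<in> words A \<Longrightarrow> [] \<otimes>\<^bsub>free_group A\<^esub> g = g"
  using mult_eq_append[of g "[]" A] mult_eq_append[of "[]" g A] by simp_all

text \<open>Each letter of \<open>v\<close> either deletes the current last letter or appends one,
  so \<open>u\<close> changes only near its end. \<open>k\<close> counts the letters lost from
  \<open>u\<close>, and \<open>z\<close> is what survives of the appended ones.\<close>

lemma mult_eq_take_append:
  assumes "u \<in> words A" "v \<in> words A"
  shows "\<exists>k z. k \<le> length v \<and> length z \<le> length v \<and>
    u \<otimes>\<^bsub>free_group A\<^esub> v = take (length u - k) u @ z"
  using assms(2)
proof (induction v rule: rev_induct)
  case Nil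
  then show ?case
    using assms mult_eq_append[of u "[]"] by auto
next
  case (snoc x v)
  interpret group "free_group A" by (rule group_free_group)
  have v: "v \<in> words A" and x: "x \<in> letters A"
    using append_in_words1[OF snoc.prems] append_in_words2[OF snoc.prems] by auto
  obtain k z where kz: "k \<le> length v" "length z \<le> length v"
    "u \<otimes>\<^bsub>free_group A\<^esub> v = take (length u - k) u @ z"
    using snoc.IH[OF v] by blast
  have "u \<otimes>\<^bsub>free_group A\<^esub> (v @ [x]) = (u \<otimes>\<^bsub>free_group A\<^esub> v) \<otimes>\<^bsub>free_group A\<^esub> [x]"
    using assms v x mult_eq_append[OF snoc.prems] m_assoc[of u v "[x]"] by simp
  also have "\<dots> = (let w = take (length u - k) u @ z in
      if w \<noteq> [] \<and> last w = inv_letter x then butlast w else w @ [x])"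
    unfolding Let_def kz(3)[symmetric] by (rule mult_snoc) (use assms v x in auto)
  finally have eq: "u \<otimes>\<^bsub>free_group A\<^esub> (v @ [x]) = (let w = take (length u - k) u @ z in
      if w \<noteq> [] \<and> last w = inv_letter x then butlast w else w @ [x])" .
  let ?w = "take (length u - k) u @ z"
  show ?case
  proof (cases "?w \<noteq> [] \<and> last ?w = inv_letter x")
    case True
    show ?thesis
    proof (cases "z = []")
      case z: True
      have "butlast (take (length u - k) u) = take (length u - Suc k) u"
        by (simp add: butlast_take)
      then show ?thesis using eq True z kz
        by (intro exI[of _ "Suc k"] exI[of _ "[]"]) simp
    next
      case False
      then show ?thesis using eq True kz
        by (intro exI[of _ k] exI[of _ "butlast z"]) (simp add: butlast_append)
    qed
  next
    case False
    then show ?thesis using eq kz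
      by (intro exI[of _ k] exI[of _ "z @ [x]"]) (auto simp: Let_def)
  qed
qed

section \<open>The boundary action\<close>

lemma boundary_letter: "\<omega> \<in> boundary A \<Longrightarrow> \<omega> i \<in> letters A"
  by (simp add: boundary_def)

lemma cons_red_inf_boundary:
  assumes "x \<in> letters A" "\<omega> \<in> boundary A"
  shows "cons_red_inf x \<omega> \<in> boundary A"
  using assms by (auto simp: boundary_def cons_red_inf_def split: nat.splits)

lemma cons_red_inf_cancel:
  assumes "\<omega> \<in> boundary A"
  shows "cons_red_inf (inv_letter x) (cons_red_inf x \<omega>) = \<omega>"
proof (cases "\<omega> 0 = inv_letter x")
  case True
  \<comment> \<open>As \<open>\<omega>\<close> is reduced, putting its deleted first letter back
    causes no second cancellation.\<close>
  then have "\<omega> (Suc 0) \<noteq> x"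
    using assms inv_letter_inv_letter[of x] unfolding boundary_def by (metis (mono_tags) mem_Collect_eq)
  then show ?thesis using True by (auto simp: cons_red_inf_def fun_eq_iff split: nat.splits)
qed (simp add: cons_red_inf_def)

lemma cons_red_inf_cancel':
  "\<omega> \<in> boundary A \<Longrightarrow> cons_red_inf x (cons_red_inf (inv_letter x) \<omega>) = \<omega>"
  using cons_red_inf_cancel[of \<omega> A "inv_letter x"] by simp

lemma boundary_act_Nil [simp]: "boundary_act [] \<omega> = \<omega>"
  by (simp add: boundary_act_def)

lemma boundary_act_Cons: "boundary_act (x # g) \<omega> = cons_red_inf x (boundary_act g \<omega>)"
  by (simp add: boundary_act_def)

lemma boundary_act_boundary:
  "set g \<subseteq> letters A \<Longrightarrow> \<omega> \<in> boundary A \<Longrightarrow> boundary_act g \<omega> \<in> boundary A"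
  by (induction g) (auto simp: boundary_act_Cons cons_red_inf_boundary)

lemma boundary_act_words:
  "g \<in> words A \<Longrightarrow> \<omega> \<in> boundary A \<Longrightarrow> boundary_act g \<omega> \<in> boundary A"
  by (simp add: boundary_act_boundary words_iff)

lemma boundary_act_cons_red:
  assumes "set u \<subseteq> letters A" "\<omega> \<in> boundary A"
  shows "boundary_act (cons_red x u) \<omega> = cons_red_inf x (boundary_act u \<omega>)"
proof (cases u)
  case (Cons y w)
  then show ?thesis
    using assms cons_red_inf_cancel'[of "boundary_act w \<omega>" A x] boundary_act_boundary[of w A \<omega>]
    by (auto simp: boundary_act_Cons)
qed (simp add: boundary_act_Cons)

lemma boundary_act_mult:
  assumes "u \<in> words A" "v \<in> words A" "\<omega> \<in> boundary A"
  shows "boundary_act (u \<otimes>\<^bsub>free_group A\<^esub> v) \<omega> = boundary_act u (boundary_act v \<omega>)"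
proof -
  have "boundary_act (foldr cons_red u v) \<omega> = boundary_act u (boundary_act v \<omega>)"
    if "set u \<subseteq> letters A" for u
    using that
  proof (induction u)
    case (Cons x u)
    then show ?case
      using set_foldr_cons_red[of u v] assms
      by (subst foldr_Cons, unfold comp_def, subst boundary_act_cons_red[of _ A])
        (auto simp: boundary_act_Cons words_iff)
  qed simp
  then show ?thesis using assms by (auto simp: mult_words words_iff)
qed

lemma boundary_act_inv:
  assumes "g \<in> words A" "\<omega> \<in> boundary A"
  shows "boundary_act (inv\<^bsub>free_group A\<^esub> g) (boundary_act g \<omega>) = \<omega>"
    and "boundary_act g (boundary_act (inv\<^bsub>free_group A\<^esub> g) \<omega>) = \<omega>"
proof -
  interpret group "free_group A" by (rule group_free_group)
  show "boundary_act (inv\<^bsub>free_group A\<^esub> g) (boundary_act g \<omega>) = \<omega>"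
    "boundary_act g (boundary_act (inv\<^bsub>free_group A\<^esub> g) \<omega>) = \<omega>"
    using assms boundary_act_mult[of "inv\<^bsub>free_group A\<^esub> g" A g \<omega>]
      boundary_act_mult[of g A "inv\<^bsub>free_group A\<^esub> g" \<omega>] by auto
qed

lemma inj_on_boundary_act: "g \<in> words A \<Longrightarrow> inj_on (boundary_act g) (boundary A)"
  by (rule inj_on_inverseI[where g = "boundary_act (inv\<^bsub>free_group A\<^esub> g)"])
    (simp add: boundary_act_inv)

lemma boundary_act_image:
  assumes "g \<in> words A" "B \<subseteq> boundary A"
  shows "boundary_act g ` B = {\<omega> \<in> boundary A. boundary_act (inv\<^bsub>free_group A\<^esub> g) \<omega> \<in> B}"
proof -
  interpret group "free_group A" by (rule group_free_group)
  show ?thesis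
  proof (intro equalityI subsetI)
    fix \<omega> assume "\<omega> \<in> {\<omega> \<in> boundary A. boundary_act (inv\<^bsub>free_group A\<^esub> g) \<omega> \<in> B}"
    then show "\<omega> \<in> boundary_act g ` B"
      using assms by (intro image_eqI[where x = "boundary_act (inv\<^bsub>free_group A\<^esub> g) \<omega>"])
        (auto simp: boundary_act_inv)
  qed (use assms in \<open>auto simp: boundary_act_inv boundary_act_words subset_iff\<close>)
qed

lemma boundary_act_eq_concat:
  assumes "g \<in> words A" "\<omega> \<in> boundary A" "g \<noteq> [] \<Longrightarrow> last g \<noteq> inv_letter (\<omega> 0)"
  shows "boundary_act g \<omega> = (\<lambda>i. if i < length g then g ! i else \<omega> (i - length g))"
  using assms(1,3)
proof (induction g)
  case (Cons x g)
  have g: "g \<in> words A" and red: "g \<noteq> [] \<Longrightarrow> hd g \<noteq> inv_letter x"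
    using Cons.prems by (auto simp: words_iff reduced_Cons)
  have IH: "boundary_act g \<omega> = (\<lambda>i. if i < length g then g ! i else \<omega> (i - length g))"
    using Cons g by (cases "g = []") auto
  have "boundary_act g \<omega> 0 \<noteq> inv_letter x"
    using red Cons.prems(2) by (cases "g = []") (auto simp: IH hd_conv_nth)
  then show ?case
    by (auto simp: boundary_act_Cons cons_red_inf_def IH fun_eq_iff split: nat.splits)
qed simp

section \<open>Prefixes of infinite words\<close>

abbreviation prefix :: "(nat \<Rightarrow> 'b) \<Rightarrow> nat \<Rightarrow> 'b list" where
  "prefix \<omega> n \<equiv> map \<omega> [0..<n]"

lemma prefix_in_words: "\<omega> \<in> boundary A \<Longrightarrow> prefix \<omega> n \<in> words A"
  by (simp add: words_iff boundary_def reduced_def image_subset_iff)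

lemma take_prefix: "k \<le> n \<Longrightarrow> take k (prefix \<omega> n) = prefix \<omega> k"
  by (simp add: take_map)

lemma cylinder_iff: "\<omega> \<in> cylinder A g \<longleftrightarrow> \<omega> \<in> boundary A \<and> prefix \<omega> (length g) = g"
  by (simp add: cylinder_def list_eq_iff_nth_eq[of "prefix \<omega> (length g)"])

lemma cylinder_Nil [simp]: "cylinder A [] = boundary A"
  by (simp add: cylinder_def)

lemma (in group) mult_inv_cancel:
  assumes "x \<in> carrier G" "y \<in> carrier G"
  shows "x \<otimes> (inv x \<otimes> y) = y" "inv x \<otimes> (x \<otimes> y) = y"
  using assms by (simp_all add: m_assoc[symmetric])

section \<open>The convex hull of a finitely generated subgroup\<close>

text \<open>The path from \<open>[]\<close> to a vertex of the Cayley tree runs through the prefixes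
  of that word, so a prefix-closed set containing \<open>[]\<close> is a subtree through the
  root.\<close>

locale invariant_tree =
  fixes A :: "'a set" and H T :: "'a letter list set"
  assumes subgroup: "subgroup H (free_group A)"
    and tree_words: "T \<subseteq> words A"
    and Nil_in_tree: "[] \<in> T"
    and prefix_in_tree: "u @ v \<in> T \<Longrightarrow> u \<in> T"
    and mult_in_tree: "h \<in> H \<Longrightarrow> t \<in> T \<Longrightarrow> h \<otimes>\<^bsub>free_group A\<^esub> t \<in> T"

text \<open>The translates of the paths from \<open>[]\<close> to the generators form a connected set of vertices of
  the Cayley tree, and a connected set containing \<open>[]\<close> is closed under prefixes.\<close>

lemma finitely_generated_hull:
  assumes "finitely_generated_subgroup H (free_group A)"
  obtains T P where "finite P" "P \<subseteq> words A" "invariant_tree A H T"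
    "T = {h \<otimes>\<^bsub>free_group A\<^esub> p |h p. h \<in> H \<and> p \<in> P}"
proof -
  interpret group "free_group A" by (rule group_free_group)
  let ?G = "free_group A"
  obtain S where S: "finite S" "S \<subseteq> words A" "H = generate ?G S" and H: "subgroup H ?G"
    using assms by (auto simp: finitely_generated_subgroup_def)
  interpret H: subgroup H ?G by (rule H)
  \<comment> \<open>Closing under inverses lets the constructors \<open>incl\<close> and
    \<open>inv\<close> of \<open>generate\<close> both be followed along a path.\<close>
  define S' where "S' = S \<union> m_inv ?G ` S"
  define P where "P = insert [] (\<Union>s\<in>S'. (\<lambda>n. take n s) ` {..length s})"
  define T where "T = {h \<otimes>\<^bsub>?G\<^esub> p |h p. h \<in> H \<and> p \<in> P}"
  \<comment> \<open>\<open>T'\<close> consists of the vertices joined to \<open>[]\<close> inside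
    \<open>T\<close>; connectedness of \<open>T\<close> amounts to
    \<open>T \<subseteq> T'\<close>.\<close>
  define T' where "T' = {w \<in> words A. \<forall>n. take n w \<in> T}"
  have S': "S' \<subseteq> words A" "finite S'"
    using S by (auto simp: S'_def)
  have P: "finite P" "P \<subseteq> words A"
    using S' by (auto simp: P_def take_in_words)
  have T_words: "T \<subseteq> words A"
    using P by (auto simp: T_def)
  have one: "[] \<in> T"
    using H.one_closed by (auto simp: T_def P_def intro!: exI[of _ "[]"])
  \<comment> \<open>An edge of the tree deletes or appends one letter, so the only prefix that can
    be new is the endpoint itself.\<close>
  have step: "w \<otimes>\<^bsub>?G\<^esub> [x] \<in> T'" if "w \<in> T'" "x \<in> letters A" "w \<otimes>\<^bsub>?G\<^esub> [x] \<in> T" for w x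
  proof -
    have w: "w \<in> words A" "\<And>n. take n w \<in> T"
      using that by (auto simp: T'_def)
    have "take n (w \<otimes>\<^bsub>?G\<^esub> [x]) \<in> T" for n
    proof (cases "w \<noteq> [] \<and> last w = inv_letter x")
      case True
      then show ?thesis
        using mult_snoc[OF w(1) that(2)] w(2)[of "min n (length w - 1)"]
        by (simp add: butlast_conv_take)
    next
      case False
      then have eq: "w \<otimes>\<^bsub>?G\<^esub> [x] = w @ [x]"
        using mult_snoc[OF w(1) that(2)] by auto
      show ?thesis
        using that(3) w(2)[of n] unfolding eq by (cases "n \<le> length w") auto
    qed
    then show ?thesis using that w by (auto simp: T'_def)
  qed
  have path: "w \<otimes>\<^bsub>?G\<^esub> take n s \<in> T'" if "w \<in> T'" "w \<in> H" "s \<in> S'" "n \<le> length s" for w s n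
    using that(4)
  proof (induction n)
    case 0
    have "w \<in> words A" using that(1) by (simp add: T'_def)
    then show ?case using that(1) by simp
  next
    case (Suc n)
    have s: "s \<in> words A" using that S' by auto
    then have x: "s ! n \<in> letters A"
      using Suc.prems nth_mem[of n s] by (auto simp: words_iff)
    have tk: "take (Suc n) s = take n s @ [s ! n]"
      using Suc.prems by (simp add: take_Suc_conv_app_nth)
    then have "take (Suc n) s = take n s \<otimes>\<^bsub>?G\<^esub> [s ! n]"
      using mult_eq_append[of "take n s" "[s ! n]" A] take_in_words[OF s, of "Suc n"] by simp
    moreover have "w \<otimes>\<^bsub>?G\<^esub> take (Suc n) s \<in> T"
      using that Suc.prems by (auto simp: T_def P_def)
    moreover have "w \<in> words A" using that(1) by (simp add: T'_def)
    ultimately show ?case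
      using step[of "w \<otimes>\<^bsub>?G\<^esub> take n s" "s ! n"] Suc x s by (simp add: m_assoc take_in_words)
  qed
  have gens: "w \<otimes>\<^bsub>?G\<^esub> s \<in> T'" if "w \<in> T'" "w \<in> H" "s \<in> S'" for w s
    using path[OF that, of "length s"] by simp
  \<comment> \<open>The base point \<open>g\<close> is arbitrary because \<open>generate\<close>
    multiplies two generated elements: the walk for \<open>h2\<close> starts where the walk for
    \<open>h1\<close> ended.\<close>
  have H_T': "g \<otimes>\<^bsub>?G\<^esub> h \<in> T'" if "h \<in> generate ?G S" "g \<in> H" "g \<in> T'" for g h
    using that
  proof (induction arbitrary: g)
    case one
    then show ?case by simp
  next
    case (incl s)
    then show ?case using gens by (simp add: S'_def)
  next
    case (inv s)
    then show ?case using gens by (simp add: S'_def)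
  next
    case (eng h1 h2)
    then have "g \<otimes>\<^bsub>?G\<^esub> h1 \<in> H" "h1 \<in> words A" "h2 \<in> words A" "g \<in> words A"
      using S H.subset H.m_closed[of g h1] by auto
    then show ?case using eng by (simp add: m_assoc[symmetric])
  qed
  have "[] \<in> T'" using one by (simp add: T'_def)
  then have "h \<in> T'" if "h \<in> H" for h
    using H_T'[of h "[]"] that S(3) H.one_closed by simp
  then have "h \<otimes>\<^bsub>?G\<^esub> p \<in> T'" if "h \<in> H" "p \<in> P" for h p
    using that path[of h] by (auto simp: P_def)
  then have "T \<subseteq> T'"
    by (auto simp: T_def)
  then have "take n w \<in> T" if "w \<in> T" for n w
    using that by (auto simp: T'_def)
  then have "u \<in> T" if "u @ v \<in> T" for u v
    using that by (metis append_eq_conv_conj)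
  moreover have "h \<otimes>\<^bsub>?G\<^esub> t \<in> T" if h: "h \<in> H" and "t \<in> T" for h t
  proof -
    obtain k p where t: "t = k \<otimes>\<^bsub>?G\<^esub> p" and kp: "k \<in> H" "p \<in> P"
      using \<open>t \<in> T\<close> unfolding T_def by blast
    have "h \<otimes>\<^bsub>?G\<^esub> t = (h \<otimes>\<^bsub>?G\<^esub> k) \<otimes>\<^bsub>?G\<^esub> p"
      using h kp P by (simp add: t m_assoc subset_iff)
    then show ?thesis using h kp by (auto simp: T_def)
  qed
  ultimately have "invariant_tree A H T"
    using H T_words one by (simp add: invariant_tree_def)
  then show ?thesis using that P T_def by blast
qed

text \<open>By finiteness of the quotient, every vertex of the tree has a vertex outside the tree within a
  fixed distance \<open>R\<close>. Seen from a point \<open>R + 1\<close> steps below \<open>t\<close>, such a vertex still lies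
  below \<open>t\<close>.\<close>

lemma infinite_index_escape:
  assumes tree: "invariant_tree A H T"
    and T_eq: "T = {h \<otimes>\<^bsub>free_group A\<^esub> p |h p. h \<in> H \<and> p \<in> P}"
    and P: "finite P" "P \<subseteq> words A"
    and inf: "infinite (rcosets\<^bsub>free_group A\<^esub> H)"
  obtains L where "\<forall>t\<in>words A. t \<noteq> [] \<longrightarrow> (\<exists>v. length v = L \<and> t @ v \<in> words A \<and> t @ v \<notin> T)"
proof -
  interpret group "free_group A" by (rule group_free_group)
  interpret T: invariant_tree A H T by (rule tree)
  let ?G = "free_group A"
  interpret H: subgroup H ?G by (rule T.subgroup)
  have "\<exists>f\<in>words A. f \<notin> T"
  proof (rule ccontr)
    assume *: "\<not> ?thesis"
    \<comment> \<open>If the tree were everything, every coset would be represented in the finite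
      set \<open>P\<close>.\<close>
    have "rcosets\<^bsub>?G\<^esub> H \<subseteq> (\<lambda>p. H #>\<^bsub>?G\<^esub> p) ` P"
    proof
      fix K assume "K \<in> rcosets\<^bsub>?G\<^esub> H"
      then obtain f where f: "f \<in> words A" "K = H #>\<^bsub>?G\<^esub> f"
        by (auto simp: RCOSETS_def)
      then obtain h p where hp: "h \<in> H" "p \<in> P" "f = h \<otimes>\<^bsub>?G\<^esub> p"
        using * by (auto simp: T_eq)
      have "H #>\<^bsub>?G\<^esub> p = K"
        unfolding f by (rule repr_independence) (use hp P T.subgroup in \<open>auto simp: r_coset_def\<close>)
      then show "K \<in> (\<lambda>p. H #>\<^bsub>?G\<^esub> p) ` P" using hp by auto
    qed
    then show False using inf finite_surj[OF P(1)] by metis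
  qed
  then obtain f where f: "f \<in> words A" "f \<notin> T" by blast
  \<comment> \<open>\<open>R\<close> bounds the tree distance from each \<open>p\<close> in
    \<open>P\<close> to \<open>f\<close>. Left translation by \<open>h\<close> preserves the
    distance and takes \<open>f\<close> to a vertex that is again outside \<open>T\<close>. The
    inserted \<open>0\<close> covers an empty \<open>P\<close>.\<close>
  define R where "R = Max (insert 0 ((\<lambda>p. length (inv\<^bsub>?G\<^esub> p \<otimes>\<^bsub>?G\<^esub> f)) ` P))"
  have near: "\<exists>g\<in>words A. length g \<le> R \<and> t \<otimes>\<^bsub>?G\<^esub> g \<notin> T" if "t \<in> T" for t
  proof -
    obtain h p where hp: "h \<in> H" "p \<in> P" "t = h \<otimes>\<^bsub>?G\<^esub> p"
      using \<open>t \<in> T\<close> by (auto simp: T_eq)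
    let ?g = "inv\<^bsub>?G\<^esub> p \<otimes>\<^bsub>?G\<^esub> f"
    have p: "p \<in> words A" using hp P by auto
    have "t \<otimes>\<^bsub>?G\<^esub> ?g = h \<otimes>\<^bsub>?G\<^esub> f"
      using hp(1) p f unfolding hp(3) by (simp add: m_assoc mult_inv_cancel)
    moreover have "h \<otimes>\<^bsub>?G\<^esub> f \<notin> T"
    proof
      assume "h \<otimes>\<^bsub>?G\<^esub> f \<in> T"
      then have "inv\<^bsub>?G\<^esub> h \<otimes>\<^bsub>?G\<^esub> (h \<otimes>\<^bsub>?G\<^esub> f) \<in> T"
        by (rule T.mult_in_tree[OF H.m_inv_closed[OF hp(1)]])
      then show False using f hp(1) by (simp add: mult_inv_cancel)
    qed
    moreover have "length ?g \<le> R"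
      unfolding R_def using P hp(2) by (intro Max_ge) auto
    ultimately show ?thesis using p f by (intro bexI[of _ ?g]) auto
  qed
  \<comment> \<open>Repeating the last letter never cancels and, by prefix closure, never re-enters
    \<open>T\<close>, so escaping words can be padded to one common length.\<close>
  have extend: "\<exists>v. length v = 2 * R + 1 \<and> t @ v \<in> words A \<and> t @ v \<notin> T"
    if "t @ v \<in> words A" "t \<noteq> []" "t @ v \<notin> T" "length v \<le> 2 * R + 1" for t v
  proof -
    let ?v = "v @ replicate (2 * R + 1 - length v) (last (t @ v))"
    have "t @ ?v \<in> words A"
      using append_replicate_in_words[OF that(1)] that(2) by simp
    moreover have "t @ ?v \<notin> T"
      using T.prefix_in_tree[of "t @ v"] that(3) by (metis append.assoc)
    ultimately show ?thesis using that(4) by (intro exI[of _ ?v]) simp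
  qed
  show thesis
  proof (rule that[of "2 * R + 1"], intro ballI impI)
    fix t assume t: "t \<in> words A" "t \<noteq> []"
    \<comment> \<open>At most \<open>R\<close> of the \<open>R + 1\<close> letters of
      \<open>?u\<close> are cancelled by \<open>g\<close>, so \<open>t\<close> survives; at most
      \<open>R\<close> letters are appended, which gives the bound \<open>2 * R + 1\<close>.\<close>
    let ?u = "replicate (Suc R) (last t)"
    have tu: "t @ ?u \<in> words A" by (rule append_replicate_in_words[OF t])
    show "\<exists>v. length v = 2 * R + 1 \<and> t @ v \<in> words A \<and> t @ v \<notin> T"
    proof (cases "t @ ?u \<in> T")
      case False
      then show ?thesis using extend[OF tu t(2)] by simp
    next
      case True
      obtain g where g: "g \<in> words A" "length g \<le> R" "(t @ ?u) \<otimes>\<^bsub>?G\<^esub> g \<notin> T"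
        using near[OF True] by blast
      obtain k z where kz: "k \<le> length g" "length z \<le> length g"
        "(t @ ?u) \<otimes>\<^bsub>?G\<^esub> g = take (length (t @ ?u) - k) (t @ ?u) @ z"
        using mult_eq_take_append[OF tu g(1)] by blast
      have "take (length (t @ ?u) - k) (t @ ?u) = t @ take (Suc R - k) ?u"
        using kz(1) g(2) by (simp del: replicate_Suc)
      then have eq: "(t @ ?u) \<otimes>\<^bsub>?G\<^esub> g = t @ take (Suc R - k) ?u @ z"
        using kz(3) by simp
      have "length (take (Suc R - k) ?u @ z) \<le> 2 * R + 1"
        using kz(2) g(2) by simp
      then show ?thesis
        using extend[OF _ t(2)] g m_closed[OF tu g(1)] unfolding eq by blast
    qed
  qed
qed

section \<open>The exit vertex of a boundary point\<close>

text \<open>The vertex \<open>t\<close> is the last one in \<open>T\<close> on the ray to \<open>\<omega>\<close>. Referring to the first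
  letter of \<open>t\<^sup>-\<^sup>1\<omega>\<close> instead of the prefixes of \<open>\<omega>\<close> makes the equivariance in
  \<open>exits_mult\<close> immediate.\<close>

definition exits :: "'a set \<Rightarrow> 'a letter list set \<Rightarrow> 'a letter list \<Rightarrow> (nat \<Rightarrow> 'a letter) \<Rightarrow> bool" where
  "exits A T t \<omega> \<longleftrightarrow>
     t \<in> T \<and> t \<otimes>\<^bsub>free_group A\<^esub> [boundary_act (inv\<^bsub>free_group A\<^esub> t) \<omega> 0] \<notin> T"

context invariant_tree
begin

text \<open>Uniqueness and existence of the exit vertex are read off from prefixes of the ray,
  equivariance from the definition; this is the bridge. A step out of \<open>T\<close> cannot lead
  back towards the root, so nothing cancels between \<open>t\<close> and the ray seen from
  \<open>t\<close>.\<close>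

lemma exits_iff:
  assumes "\<omega> \<in> boundary A"
  shows "exits A T t \<omega> \<longleftrightarrow>
    t \<in> T \<and> prefix \<omega> (length t) = t \<and> prefix \<omega> (Suc (length t)) \<notin> T"
proof -
  interpret group "free_group A" by (rule group_free_group)
  let ?G = "free_group A"
  show ?thesis
  proof (cases "t \<in> T")
    case True
    then have t: "t \<in> words A" using tree_words by auto
    define \<eta> where "\<eta> = boundary_act (inv\<^bsub>?G\<^esub> t) \<omega>"
    have \<eta>: "\<eta> \<in> boundary A" "boundary_act t \<eta> = \<omega>"
      using t assms by (auto simp: \<eta>_def boundary_act_words boundary_act_inv)
    have left: "prefix \<omega> (length t) = t \<and> prefix \<omega> (Suc (length t)) \<notin> T"
      if ex: "t \<otimes>\<^bsub>?G\<^esub> [\<eta> 0] \<notin> T"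
    proof -
      have not: "\<not> (t \<noteq> [] \<and> last t = inv_letter (\<eta> 0))"
      proof
        assume *: "t \<noteq> [] \<and> last t = inv_letter (\<eta> 0)"
        then have "t \<otimes>\<^bsub>?G\<^esub> [\<eta> 0] = butlast t"
          using mult_snoc[OF t boundary_letter[OF \<eta>(1), of 0]] by simp
        moreover have "butlast t \<in> T"
          using prefix_in_tree[of "butlast t" "[last t]"] True * by (metis append_butlast_last_id)
        ultimately show False using ex by simp
      qed
      have \<omega>: "\<omega> = (\<lambda>i. if i < length t then t ! i else \<eta> (i - length t))"
        using boundary_act_eq_concat[OF t \<eta>(1)] not \<eta>(2) by auto
      have pre: "prefix \<omega> (length t) = t"
        by (rule nth_equalityI) (auto simp: \<omega>)
      have "t \<otimes>\<^bsub>?G\<^esub> [\<eta> 0] = t @ [\<eta> 0]"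
        by (simp only: mult_snoc[OF t boundary_letter[OF \<eta>(1)]] not if_False)
      moreover have "\<omega> (length t) = \<eta> 0" by (simp add: \<omega>)
      ultimately have "prefix \<omega> (Suc (length t)) = t \<otimes>\<^bsub>?G\<^esub> [\<eta> 0]"
        using pre by simp
      then show ?thesis using pre ex by simp
    qed
    have right: "t \<otimes>\<^bsub>?G\<^esub> [\<eta> 0] \<notin> T"
      if pre: "prefix \<omega> (length t) = t" and ex: "prefix \<omega> (Suc (length t)) \<notin> T"
    proof -
      define \<zeta> where "\<zeta> = (\<lambda>i. \<omega> (i + length t))"
      have \<zeta>: "\<zeta> \<in> boundary A"
        using assms by (simp add: \<zeta>_def boundary_def)
      have suc: "prefix \<omega> (Suc (length t)) = t @ [\<zeta> 0]"
        using pre by (simp add: \<zeta>_def)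
      have tw: "t @ [\<zeta> 0] \<in> words A"
        using prefix_in_words[OF assms] suc by metis
      then have last: "t \<noteq> [] \<Longrightarrow> last t \<noteq> inv_letter (\<zeta> 0)"
        by (auto simp: words_iff reduced_append)
      have nth: "\<omega> i = t ! i" if "i < length t" for i
        using arg_cong[OF pre, of "\<lambda>w. w ! i"] that by simp
      have "boundary_act t \<zeta> = \<omega>"
        using boundary_act_eq_concat[OF t \<zeta> last] by (auto simp: \<zeta>_def nth)
      then have "\<zeta> = \<eta>"
        using boundary_act_inv(1)[OF t \<zeta>] by (simp add: \<eta>_def)
      then show ?thesis
        using mult_eq_append[OF tw] suc ex by simp
    qed
    show ?thesis
      using True left right by (auto simp: exits_def \<eta>_def simp del: upt_Suc)
  qed (simp add: exits_def)
qed

lemma take_in_tree: "t \<in> T \<Longrightarrow> take n t \<in> T"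
  using prefix_in_tree[of "take n t" "drop n t"] by simp

text \<open>If two exits had different lengths, then one step past the shorter one the ray would
  still be at a prefix of the longer one, hence in \<open>T\<close>.\<close>

lemma exits_unique:
  assumes "\<omega> \<in> boundary A" "exits A T t \<omega>" "exits A T u \<omega>"
  shows "t = u"
proof -
  have "\<not> length t < length u"
    if "exits A T t \<omega>" "exits A T u \<omega>" for t u
  proof
    assume "length t < length u"
    then have "prefix \<omega> (Suc (length t)) = take (Suc (length t)) (prefix \<omega> (length u))"
      by (intro take_prefix[symmetric]) simp
    then show False
      using that assms(1) take_in_tree[of u "Suc (length t)"]
      by (simp add: exits_iff del: upt_Suc)
  qed
  then have "length t = length u"
    using assms by (meson linorder_neqE_nat)
  then show ?thesis using assms by (metis exits_iff)
qed

lemma exits_exist: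
  assumes "\<omega> \<in> boundary A" "prefix \<omega> n \<notin> T"
  shows "\<exists>t. exits A T t \<omega>"
proof -
  \<comment> \<open>The first prefix outside \<open>T\<close> is not \<open>[]\<close>, so it has a
    predecessor, which is the exit vertex.\<close>
  define k where "k = (LEAST n. prefix \<omega> n \<notin> T)"
  have k: "prefix \<omega> k \<notin> T" "\<And>j. j < k \<Longrightarrow> prefix \<omega> j \<in> T"
    unfolding k_def using assms(2) by (rule LeastI) (blast dest: not_less_Least)
  then have "k \<noteq> 0" using Nil_in_tree by (metis list.map_disc_iff upt_0)
  then obtain j where "k = Suc j" by (auto simp: gr0_conv_Suc)
  then show ?thesis
    using k assms(1) by (intro exI[of _ "prefix \<omega> j"]) (simp add: exits_iff del: upt_Suc)
qed

lemma exits_mult: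
  assumes "h \<in> H" "\<omega> \<in> boundary A" "exits A T t \<omega>"
  shows "exits A T (h \<otimes>\<^bsub>free_group A\<^esub> t) (boundary_act h \<omega>)"
proof -
  interpret group "free_group A" by (rule group_free_group)
  interpret H: subgroup H "free_group A" by (rule subgroup)
  let ?G = "free_group A"
  have t: "t \<in> T" "t \<in> words A" using assms(3) tree_words by (auto simp: exits_def)
  have h: "h \<in> words A" using assms(1) by simp
  let ?y = "boundary_act (inv\<^bsub>?G\<^esub> t) \<omega> 0"
  have y: "[?y] \<in> words A"
    using boundary_act_words[of "inv\<^bsub>?G\<^esub> t" A \<omega>] assms(2) t by (simp add: boundary_letter)
  \<comment> \<open>Seen from the moved vertex, the moved ray starts with the same letter as before,
    so the vertex after the exit is moved by \<open>h\<close> as well.\<close>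
  have "boundary_act (inv\<^bsub>?G\<^esub> (h \<otimes>\<^bsub>?G\<^esub> t)) (boundary_act h \<omega>) = boundary_act (inv\<^bsub>?G\<^esub> t) \<omega>"
    using assms(2) t h
    by (simp add: inv_mult_group boundary_act_mult boundary_act_inv boundary_act_words)
  moreover have "(h \<otimes>\<^bsub>?G\<^esub> t) \<otimes>\<^bsub>?G\<^esub> [?y] \<notin> T"
  proof
    assume "(h \<otimes>\<^bsub>?G\<^esub> t) \<otimes>\<^bsub>?G\<^esub> [?y] \<in> T"
    then have "inv\<^bsub>?G\<^esub> h \<otimes>\<^bsub>?G\<^esub> ((h \<otimes>\<^bsub>?G\<^esub> t) \<otimes>\<^bsub>?G\<^esub> [?y]) \<in> T"
      by (rule mult_in_tree[OF H.m_inv_closed[OF assms(1)]])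
    moreover have "inv\<^bsub>?G\<^esub> h \<otimes>\<^bsub>?G\<^esub> ((h \<otimes>\<^bsub>?G\<^esub> t) \<otimes>\<^bsub>?G\<^esub> [?y]) = t \<otimes>\<^bsub>?G\<^esub> [?y]"
      using t h y by (simp add: m_assoc mult_inv_cancel)
    ultimately show False using assms(3) by (simp add: exits_def)
  qed
  ultimately show ?thesis using mult_in_tree[OF assms(1) t(1)] by (simp add: exits_def)
qed

end

section \<open>The uniform measure\<close>

lemma cylinder_subset_boundary: "cylinder A g \<subseteq> boundary A"
  by (auto simp: cylinder_def)

lemma openin_cylinder: "openin (boundary_topology A) (cylinder A g)"
proof -
  \<comment> \<open>The intersection with \<open>letters A\<close> keeps each factor open even if
    \<open>g\<close> contains a foreign letter.\<close>
  let ?S = "\<lambda>i. if i < length g then {g ! i} \<inter> letters A else letters A"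
  have "openin (product_topology (\<lambda>_. discrete_topology (letters A)) UNIV) (PiE UNIV ?S)"
    by (rule openin_PiE_gen[THEN iffD2])
      (auto intro!: disjI2 intro: finite_subset[of _ "{..<length g}"])
  moreover have "cylinder A g = PiE UNIV ?S \<inter> boundary A"
    by (auto simp: cylinder_def boundary_def PiE_iff split: if_splits) metis
  ultimately show ?thesis
    by (auto simp: boundary_topology_def openin_subtopology)
qed

lemma openin_boundary_imp_cylinder:
  assumes "openin (boundary_topology A) U" "\<omega> \<in> U"
  shows "\<exists>n. cylinder A (prefix \<omega> n) \<subseteq> U"
proof -
  obtain V where V: "openin (product_topology (\<lambda>_. discrete_topology (letters A)) UNIV) V"
    "U = V \<inter> boundary A"
    using assms(1) by (auto simp: boundary_topology_def openin_subtopology)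
  then obtain W where W: "finite {i. W i \<noteq> letters A}" "\<omega> \<in> PiE UNIV W" "PiE UNIV W \<subseteq> V"
    using assms(2) unfolding openin_product_topology_alt by (auto simp: Ball_def)
  then obtain n where n: "{i. W i \<noteq> letters A} \<subseteq> {..<n}"
    using finite_nat_iff_bounded by blast
  have "cylinder A (prefix \<omega> n) \<subseteq> U"
  proof
    fix \<eta> assume \<eta>: "\<eta> \<in> cylinder A (prefix \<omega> n)"
    have "\<eta> i \<in> W i" for i
    proof (cases "i < n")
      case True
      then have "\<eta> i = \<omega> i" using \<eta> by (simp add: cylinder_def)
      then show ?thesis using W(2) by (auto simp: PiE_iff)
    next
      case False
      then have "W i = letters A" using n by auto
      then show ?thesis using \<eta> by (simp add: cylinder_def boundary_def)
    qed
    then show "\<eta> \<in> U" using W(3) V(2) \<eta> by (auto simp: PiE_iff cylinder_def)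
  qed
  then show ?thesis ..
qed

lemma cylinder_Int:
  assumes "length u \<le> length v"
  shows "cylinder A u \<inter> cylinder A v = (if take (length u) v = u then cylinder A v else {})"
  using assms
  by (auto simp: cylinder_iff) (metis take_prefix)+

text \<open>The first letter of \<open>u\<close> prevents any cancellation with \<open>g\<close>.
  For \<open>u = []\<close> the image is the whole boundary, which is not the cylinder of a
  non-empty \<open>g\<close>.\<close>

lemma boundary_act_cylinder:
  assumes "g @ u \<in> words A" "u \<noteq> []"
  shows "boundary_act g ` cylinder A u = cylinder A (g @ u)"
proof -
  have g: "g \<in> words A" using assms append_in_words1 by blast
  have act: "boundary_act g \<omega> = (\<lambda>i. if i < length g then g ! i else \<omega> (i - length g))"
    if "\<omega> \<in> cylinder A u" for \<omega>
  proof (rule boundary_act_eq_concat[OF g])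
    have "\<omega> 0 = hd u" using that assms(2) by (auto simp: cylinder_def hd_conv_nth)
    then show "g \<noteq> [] \<Longrightarrow> last g \<noteq> inv_letter (\<omega> 0)"
      using assms by (auto simp: words_iff reduced_append)
  qed (use that in \<open>auto simp: cylinder_def\<close>)
  show ?thesis
  proof (intro equalityI subsetI)
    fix \<eta> assume "\<eta> \<in> boundary_act g ` cylinder A u"
    then obtain \<omega> where \<omega>: "\<omega> \<in> cylinder A u" "\<eta> = boundary_act g \<omega>" by auto
    have "\<eta> \<in> boundary A"
      using \<omega> g cylinder_subset_boundary boundary_act_words by blast
    moreover have "\<eta> i = (g @ u) ! i" if "i < length (g @ u)" for i
      using that \<omega> act[OF \<omega>(1)] by (auto simp: cylinder_def nth_append)
    ultimately show "\<eta> \<in> cylinder A (g @ u)" by (simp add: cylinder_def)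
  next
    fix \<eta> assume \<eta>: "\<eta> \<in> cylinder A (g @ u)"
    define \<omega> where "\<omega> = (\<lambda>i. \<eta> (i + length g))"
    have "\<omega> \<in> cylinder A u"
      using \<eta> by (auto simp: cylinder_def boundary_def \<omega>_def nth_append)
    moreover have "boundary_act g \<omega> = \<eta>"
      using \<eta> act[OF \<open>\<omega> \<in> cylinder A u\<close>]
      by (auto simp: cylinder_def \<omega>_def nth_append fun_eq_iff)
    ultimately show "\<eta> \<in> boundary_act g ` cylinder A u" by blast
  qed
qed

section \<open>Measurable sets and cylinders\<close>

locale uniform_boundary =
  fixes A :: "'a set" and M :: "(nat \<Rightarrow> 'a letter) measure"
  assumes finite_alphabet: "finite A" and card_alphabet: "card A \<ge> 2"
    and uniform: "is_uniform_measure A M"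
begin

sublocale prob_space M
  using uniform by (simp add: is_uniform_measure_def)

lemma space_M [simp]: "space M = boundary A"
  using uniform by (simp add: is_uniform_measure_def)

lemma sets_subset: "B \<in> sets M \<Longrightarrow> B \<subseteq> boundary A"
  using sets.sets_into_space by force

definition q :: real where
  "q = 2 * real (card A) - 1"

lemma q_ge: "q \<ge> 3"
  using card_alphabet by (simp add: q_def)

lemma finite_letters: "finite (letters A)"
  using finite_alphabet by (simp add: letters_def)

lemma card_letters: "real (card (letters A)) = q + 1"
  by (simp add: letters_def card_cartesian_product q_def)

lemma countable_words: "countable (words A)"
  by (rule countable_subset[of _ "lists (letters A)"])
    (auto simp: words_iff countable_finite finite_letters)

lemma finite_words_length: "finite {w \<in> words A. length w = n}"
  by (rule finite_subset[OF _ finite_lists_length_eq[OF finite_letters, of n]])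
    (auto simp: words_iff)

lemma measure_cylinder:
  assumes "g \<in> words A" "g \<noteq> []"
  shows "measure M (cylinder A g) = 1 / ((q + 1) * q ^ (length g - 1))"
  using uniform assms by (simp add: is_uniform_measure_def q_def)

lemma cylinder_sets [measurable]: "cylinder A g \<in> sets M"
  using uniform openin_cylinder[of A g] by (auto simp: is_uniform_measure_def)

text \<open>There are only countably many words, so an open set is a countable union of the
  cylinders it contains. Measurability of maps and equality of measures can thus be tested on
  cylinders.\<close>

lemma sets_eq_cylinders: "sets M = sigma_sets (boundary A) (cylinder A ` words A)"
proof -
  interpret C: sigma_algebra "boundary A" "sigma_sets (boundary A) (cylinder A ` words A)"
    by (rule sigma_algebra_sigma_sets) (use cylinder_subset_boundary in auto)
  have "U \<in> sigma_sets (boundary A) (cylinder A ` words A)"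
    if U: "openin (boundary_topology A) U" for U
  proof -
    have sub: "U \<subseteq> boundary A"
      using openin_subset[OF U] by (auto simp: boundary_topology_def)
    have "U = (\<Union>w\<in>{w \<in> words A. cylinder A w \<subseteq> U}. cylinder A w)"
    proof (intro equalityI subsetI)
      fix \<omega> assume \<omega>: "\<omega> \<in> U"
      then obtain n where "cylinder A (prefix \<omega> n) \<subseteq> U"
        using openin_boundary_imp_cylinder[OF U] by blast
      then show "\<omega> \<in> (\<Union>w\<in>{w \<in> words A. cylinder A w \<subseteq> U}. cylinder A w)"
        using \<omega> sub by (intro UN_I[of "prefix \<omega> n"]) (auto simp: prefix_in_words cylinder_iff)
    qed auto
    moreover have "(\<Union>w\<in>{w \<in> words A. cylinder A w \<subseteq> U}. cylinder A w)
        \<in> sigma_sets (boundary A) (cylinder A ` words A)"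
      by (rule C.countable_UN'') (auto intro: countable_subset[OF _ countable_words])
    ultimately show ?thesis by simp
  qed
  then have "sets M \<subseteq> sigma_sets (boundary A) (cylinder A ` words A)"
    using uniform by (auto simp: is_uniform_measure_def intro: sigma_sets_mono[THEN subsetD, rotated])
  moreover have "sigma_sets (boundary A) (cylinder A ` words A) \<subseteq> sets M"
    using sets.sigma_sets_subset[of "cylinder A ` words A" M] cylinder_sets by (simp add: image_subset_iff)
  ultimately show ?thesis by blast
qed

lemma prefix_sets: "{\<omega> \<in> boundary A. P (prefix \<omega> n)} \<in> sets M"
proof -
  have "{\<omega> \<in> boundary A. P (prefix \<omega> n)} = (\<Union>w\<in>{w \<in> words A. length w = n \<and> P w}. cylinder A w)"
    by (auto simp: cylinder_iff prefix_in_words)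
  also have "\<dots> \<in> sets M"
    by (rule sets.countable_UN'') (auto intro: countable_subset[OF _ countable_words])
  finally show ?thesis .
qed

lemma first_letter_sets: "{\<omega> \<in> boundary A. P (\<omega> 0)} \<in> sets M"
  using prefix_sets[of "\<lambda>w. P (hd w)" 1] by simp

section \<open>Measurability of the boundary action\<close>

lemma cons_red_inf_measurable:
  assumes "x \<in> letters A"
  shows "cons_red_inf x \<in> measurable M M"
proof (rule measurable_sigma_sets[OF sets_eq_cylinders])
  show "cons_red_inf x \<in> space M \<rightarrow> boundary A"
    using assms by (simp add: cons_red_inf_boundary)
  fix C assume "C \<in> cylinder A ` words A"
  then obtain w where C: "C = cylinder A w" by auto
  let ?n = "length w"
  \<comment> \<open>One extra input letter is read, since a cancellation removes the first
    one.\<close>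
  have "prefix (cons_red_inf x \<omega>) ?n = take ?n (cons_red x (prefix \<omega> (Suc ?n)))" for \<omega>
  proof -
    have *: "prefix \<omega> (Suc ?n) = \<omega> 0 # map (\<lambda>i. \<omega> (Suc i)) [0..<?n]"
      by (rule nth_equalityI) (auto simp: nth_Cons simp del: upt_Suc split: nat.split)
    have "prefix (case_nat x \<omega>) ?n = take ?n (x # prefix \<omega> (Suc ?n))"
      by (rule nth_equalityI) (auto simp: nth_Cons simp del: upt_Suc split: nat.split)
    then show ?thesis
      by (simp add: cons_red_inf_def * take_map del: upt_Suc)
  qed
  then have "cons_red_inf x -` C \<inter> space M =
      {\<omega> \<in> boundary A. take ?n (cons_red x (prefix \<omega> (Suc ?n))) = w}"
    using assms by (auto simp: C cylinder_iff cons_red_inf_boundary simp del: upt_Suc)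
  then show "cons_red_inf x -` C \<inter> space M \<in> sets M"
    using prefix_sets[of "\<lambda>v. take ?n (cons_red x v) = w" "Suc ?n"] by (simp del: upt_Suc)
qed (use cylinder_subset_boundary in auto)

lemma boundary_act_measurable:
  assumes "g \<in> words A"
  shows "boundary_act g \<in> measurable M M"
proof -
  have "boundary_act g \<in> measurable M M" if "set g \<subseteq> letters A"
    using that
  proof (induction g)
    case Nil
    then show ?case by (simp add: boundary_act_def)
  next
    case (Cons x g)
    then have "cons_red_inf x \<circ> boundary_act g \<in> measurable M M"
      using cons_red_inf_measurable[of x] by (intro measurable_comp[of _ M M]) auto
    then show ?case by (simp add: boundary_act_def comp_def)
  qed
  then show ?thesis using assms by (simp add: words_iff)
qed

lemma boundary_act_vimage_sets:
  assumes "g \<in> words A" "B \<in> sets M"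
  shows "{\<omega> \<in> boundary A. boundary_act g \<omega> \<in> B} \<in> sets M"
  using measurable_sets[OF boundary_act_measurable[OF assms(1)] assms(2)]
  by (simp add: vimage_def Int_def conj_commute)

lemma boundary_act_image_sets:
  assumes "g \<in> words A" "B \<in> sets M"
  shows "boundary_act g ` B \<in> sets M"
  using assms group.inv_closed[OF group_free_group assms(1)]
  by (simp add: boundary_act_image sets_subset boundary_act_vimage_sets)

section \<open>Scaling of the uniform measure under the action\<close>

lemma measure_first_letter:
  assumes "finite_measure N" "sets N = sets M" "C \<in> sets M"
  shows "measure N C = (\<Sum>x\<in>letters A. measure N (C \<inter> cylinder A [x]))"
proof -
  interpret N: finite_measure N by (rule assms(1))
  have "C = (\<Union>x\<in>letters A. C \<inter> cylinder A [x])"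
    using sets_subset[OF assms(3)] boundary_letter by (fastforce simp: cylinder_def)
  moreover have "measure N (\<Union>x\<in>letters A. C \<inter> cylinder A [x]) =
      (\<Sum>x\<in>letters A. measure N (C \<inter> cylinder A [x]))"
  proof (rule N.finite_measure_finite_Union[OF finite_letters])
    show "(\<lambda>x. C \<inter> cylinder A [x]) ` letters A \<subseteq> sets N"
      unfolding assms(2) using assms(3) cylinder_sets by blast
    have "cylinder A [x] \<inter> cylinder A [y] = {}" if "x \<noteq> y" for x y
      using that by (auto simp: cylinder_def)
    then show "disjoint_family_on (\<lambda>x. C \<inter> cylinder A [x]) (letters A)"
      unfolding disjoint_family_on_def by blast
  qed
  ultimately show ?thesis by metis
qed

text \<open>Cylinders are nested or disjoint, so together with the empty set they form an
  intersection-stable generator; the factor \<open>c\<close> is absorbed into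
  \<open>scale_measure\<close>. The case of the empty word follows from \<open>eq\<close> by summing
  over the first letters.\<close>

lemma measure_eq_if_cylinders:
  assumes "finite_measure N1" "sets N1 = sets M" "finite_measure N2" "sets N2 = sets M" "c \<ge> 0"
    and eq: "\<And>w. w \<in> words A \<Longrightarrow> w \<noteq> [] \<Longrightarrow>
      measure N1 (cylinder A w) = c * measure N2 (cylinder A w)"
    and C: "C \<in> sets M"
  shows "measure N1 C = c * measure N2 C"
proof -
  interpret N1: finite_measure N1 by (rule assms(1))
  interpret N2: finite_measure N2 by (rule assms(3))
  let ?N = "scale_measure (ennreal c) N2"
  let ?E = "insert {} (cylinder A ` words A)"
  have eq': "measure N1 (cylinder A w) = c * measure N2 (cylinder A w)" if "w \<in> words A" for w
  proof (cases "w = []")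
    case True
    then show ?thesis
      using measure_first_letter[OF assms(1,2), of "boundary A"] eq
        measure_first_letter[OF assms(3,4), of "boundary A"] sets.top[of M]
      by (simp add: Int_absorb1[OF cylinder_subset_boundary] sum_distrib_left)
  qed (use eq that in auto)
  have "N1 = ?N"
  proof (rule measure_eqI_generator_eq[of ?E "boundary A" _ _ "\<lambda>_. boundary A"])
    show "Int_stable ?E"
    proof (rule Int_stableI)
      have "cylinder A u \<inter> cylinder A v \<in> ?E" if "u \<in> words A" "v \<in> words A" for u v
        using that cylinder_Int[of u v A] cylinder_Int[of v u A]
        by (cases "length u \<le> length v") (auto simp: Int_commute)
      then show "X \<inter> Y \<in> ?E" if "X \<in> ?E" "Y \<in> ?E" for X Y
        using that by auto
    qed
    show "emeasure N1 X = emeasure ?N X" if "X \<in> ?E" for X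
      using that eq' assms(5)
      by (auto simp: N1.emeasure_eq_measure N2.emeasure_eq_measure ennreal_mult)
    have "sigma_sets (boundary A) ?E = sets M"
      unfolding sets_eq_cylinders
      by (rule sigma_sets_eqI) (auto intro: sigma_sets.Empty)
    then show "sets N1 = sigma_sets (boundary A) ?E" "sets ?N = sigma_sets (boundary A) ?E"
      using assms by auto
    show "range (\<lambda>_. boundary A) \<subseteq> ?E"
      by (auto intro!: image_eqI[of _ _ "[]"])
  qed (use cylinder_subset_boundary in auto)
  then have "measure N1 C = measure ?N C" by simp
  then show ?thesis using assms(5) by (simp add: measure_def enn2real_mult)
qed

lemma cons_red_inf_image:
  assumes "x \<in> letters A" "C \<subseteq> boundary A"
  shows "cons_red_inf x ` C = {\<omega> \<in> boundary A. cons_red_inf (inv_letter x) \<omega> \<in> C}"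
proof (intro equalityI subsetI)
  fix \<omega> assume "\<omega> \<in> {\<omega> \<in> boundary A. cons_red_inf (inv_letter x) \<omega> \<in> C}"
  then show "\<omega> \<in> cons_red_inf x ` C"
    using cons_red_inf_cancel'[of \<omega> A x] by (auto intro!: image_eqI[of \<omega>])
next
  fix \<omega> assume "\<omega> \<in> cons_red_inf x ` C"
  then show "\<omega> \<in> {\<omega> \<in> boundary A. cons_red_inf (inv_letter x) \<omega> \<in> C}"
    using assms cons_red_inf_cancel[of _ A x] cons_red_inf_boundary[of x A] by (auto simp: subset_iff)
qed

text \<open>Prepending \<open>x\<close> without cancellation makes a word one letter longer, so its
  cylinder shrinks by \<open>q\<close>. To pass from cylinders to all measurable sets, both sides
  have to be measures: the image under \<open>x\<close> is written as a preimage under the inverse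
  letter, inside the cylinder of \<open>x\<close>.\<close>

lemma measure_cons_red_inf:
  assumes x: "x \<in> letters A" and C: "C \<in> sets M" "\<And>\<omega>. \<omega> \<in> C \<Longrightarrow> \<omega> 0 \<noteq> inv_letter x"
  shows "measure M (cons_red_inf x ` C) = measure M C / q"
proof -
  define S where "S = {\<omega> \<in> boundary A. \<omega> 0 \<noteq> inv_letter x}"
  have S: "S \<in> sets M"
    unfolding S_def by (rule first_letter_sets)
  have x': "inv_letter x \<in> letters A" using x by simp
  let ?N1 = "distr (density M (indicator (cylinder A [x]))) M (cons_red_inf (inv_letter x))"
  let ?N2 = "density M (indicator S)"
  have image: "cons_red_inf x ` (S \<inter> D) = cylinder A [x] \<inter> (cons_red_inf (inv_letter x) -` D \<inter> boundary A)"
    if D: "D \<subseteq> boundary A" for D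
  proof -
    have "cons_red_inf x ` (S \<inter> D) = {\<omega> \<in> boundary A. cons_red_inf (inv_letter x) \<omega> \<in> S \<inter> D}"
      by (rule cons_red_inf_image) (use x D in auto)
    moreover have "cons_red_inf (inv_letter x) \<omega> \<in> S \<longleftrightarrow> \<omega> 0 = x" if "\<omega> \<in> boundary A" for \<omega>
    proof -
      have "\<omega> (Suc 0) \<noteq> inv_letter (\<omega> 0)" using that by (simp add: boundary_def)
      then show ?thesis
        using cons_red_inf_boundary[OF x' that]
        by (auto simp: S_def cons_red_inf_def)
    qed
    ultimately show ?thesis by (auto simp: cylinder_def)
  qed
  have N1: "measure ?N1 D = measure M (cons_red_inf x ` (S \<inter> D))" if D: "D \<in> sets M" for D
  proof -
    have "cons_red_inf (inv_letter x) \<in> measurable (density M (indicator (cylinder A [x]))) M"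
      using cons_red_inf_measurable[OF x'] by simp
    then have "measure ?N1 D = measure (density M (indicator (cylinder A [x])))
        (cons_red_inf (inv_letter x) -` D \<inter> boundary A)"
      using D by (subst measure_distr) auto
    also have "\<dots> = measure M (cylinder A [x] \<inter> (cons_red_inf (inv_letter x) -` D \<inter> boundary A))"
      using measurable_sets[OF cons_red_inf_measurable[OF x'] D] by (intro measure_restricted) auto
    finally show ?thesis using image[OF sets_subset[OF D]] by simp
  qed
  have N2: "measure ?N2 D = measure M (S \<inter> D)" if "D \<in> sets M" for D
    using that S by (intro measure_restricted) auto
  have "measure ?N1 C = 1 / q * measure ?N2 C"
  proof (rule measure_eq_if_cylinders)
    interpret X: finite_measure "density M (indicator (cylinder A [x]))"
      by (rule finite_measure_restricted) simp
    show "finite_measure ?N1"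
      using cons_red_inf_measurable[OF x'] by (intro X.finite_measure_distr) simp
    show "finite_measure ?N2" by (rule finite_measure_restricted[OF S])
    fix w assume w: "w \<in> words A" "w \<noteq> []"
    show "measure ?N1 (cylinder A w) = 1 / q * measure ?N2 (cylinder A w)"
    proof (cases "hd w = inv_letter x")
      case True
      then have "S \<inter> cylinder A w = {}"
        using w by (auto simp: S_def cylinder_def hd_conv_nth)
      then show ?thesis by (simp add: N1 N2)
    next
      case False
      then have *: "S \<inter> cylinder A w = cylinder A w"
        using w by (auto simp: S_def cylinder_def hd_conv_nth)
      have xw: "[x] @ w \<in> words A"
        using w x False by (auto simp: words_iff reduced_Cons)
      have "cons_red_inf x ` cylinder A w = cylinder A (x # w)"
        using boundary_act_cylinder[OF xw w(2)] by (simp add: boundary_act_def)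
      then show ?thesis
        using measure_cylinder[OF xw] measure_cylinder[OF w] w(2) q_ge
        by (simp add: N1 N2 * power_eq_if[of q "length w"])
    qed
  qed (use C q_ge in auto)
  moreover have "S \<inter> C = C" using C sets_subset by (auto simp: S_def)
  ultimately show ?thesis using C by (simp add: N1 N2)
qed

lemma measure_boundary_act:
  assumes "g @ [x] \<in> words A" "C \<in> sets M" "C \<subseteq> cylinder A [x]"
  shows "measure M (boundary_act g ` C) = measure M C / q ^ length g"
  using assms(1)
proof (induction g)
  case (Cons y g)
  have g: "g @ [x] \<in> words A" and y: "y \<in> letters A"
    using Cons.prems by (auto simp: words_iff reduced_Cons)
  have D: "boundary_act g ` C \<in> sets M"
    using boundary_act_image_sets[OF append_in_words1[OF g] assms(2)] .
  have "boundary_act g ` C \<subseteq> cylinder A (g @ [x])"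
    using boundary_act_cylinder[OF g] assms(3) by auto
  then have "\<omega> 0 = hd (g @ [x])" if "\<omega> \<in> boundary_act g ` C" for \<omega>
    using that by (auto simp: cylinder_def hd_conv_nth)
  moreover have "hd (g @ [x]) \<noteq> inv_letter y"
    using Cons.prems by (auto simp: words_iff reduced_Cons)
  ultimately have "measure M (cons_red_inf y ` boundary_act g ` C) =
      measure M (boundary_act g ` C) / q"
    using measure_cons_red_inf[OF y D] by metis
  moreover have "boundary_act (y # g) ` C = cons_red_inf y ` boundary_act g ` C"
    by (auto simp: boundary_act_Cons image_image)
  ultimately show ?case using Cons.IH[OF g] by simp
qed simp

end

section \<open>Harmonic functions on a finite quotient\<close>

text \<open>The states \<open>(H g, x)\<close> with transitions to \<open>(H g x, y)\<close>, where \<open>y\<close> is not inverse to \<open>x\<close>,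
  form a finite Markov chain whose transition matrix is doubly stochastic. Hence the energy
  of a harmonic function vanishes, that is, it is constant along transitions.\<close>

lemma (in uniform_boundary) harmonic_const:
  fixes \<phi> :: "'a letter list \<Rightarrow> 'a letter \<Rightarrow> real"
  assumes H: "subgroup H (free_group A)" and fin: "finite (rcosets\<^bsub>free_group A\<^esub> H)"
    and inv: "\<And>h g x. h \<in> H \<Longrightarrow> g \<in> words A \<Longrightarrow> x \<in> letters A \<Longrightarrow>
      \<phi> (h \<otimes>\<^bsub>free_group A\<^esub> g) x = \<phi> g x"
    and harmonic: "\<And>g x. g \<in> words A \<Longrightarrow> x \<in> letters A \<Longrightarrow>
      q * \<phi> g x = (\<Sum>y\<in>letters A - {inv_letter x}. \<phi> (g \<otimes>\<^bsub>free_group A\<^esub> [x]) y)"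
  obtains c where "\<And>g x. g \<in> words A \<Longrightarrow> x \<in> letters A \<Longrightarrow> \<phi> g x = c"
proof -
  interpret group "free_group A" by (rule group_free_group)
  let ?G = "free_group A"
  interpret H: subgroup H ?G by (rule H)
  let ?R = "rcosets\<^bsub>?G\<^esub> H" and ?L = "letters A"
  \<comment> \<open>By \<open>inv\<close>, \<open>\<phi>\<close> descends to right cosets, so the
    chosen representative does not matter.\<close>
  define \<Phi> where "\<Phi> K x = \<phi> (SOME g. g \<in> K) x" for K x
  define next_letters where "next_letters x = ?L - {inv_letter x}" for x
  have succ: "finite (next_letters x)" "next_letters x \<subseteq> ?L" for x
    using finite_letters by (auto simp: next_letters_def)
  have card_next: "real (card (next_letters x)) = q" if "x \<in> ?L" for x
    using that card_letters finite_letters q_ge by (simp add: next_letters_def of_nat_diff card_Diff_singleton)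
  have \<Phi>: "\<Phi> (H #>\<^bsub>?G\<^esub> g) x = \<phi> g x" if g: "g \<in> words A" and x: "x \<in> ?L" for g x
  proof -
    have "(SOME k. k \<in> H #>\<^bsub>?G\<^esub> g) \<in> H #>\<^bsub>?G\<^esub> g"
      using rcos_self[OF g H] by (rule someI)
    then show ?thesis using g x by (auto simp: \<Phi>_def r_coset_def inv)
  qed
  have shift: "(\<Sum>K\<in>?R. f (K #>\<^bsub>?G\<^esub> [x])) = (\<Sum>K\<in>?R. f K)" if x: "x \<in> ?L" for f :: "_ \<Rightarrow> real" and x
  proof (rule sum.reindex_bij_betw)
    have in_R: "K #>\<^bsub>?G\<^esub> a \<in> ?R" if "K \<in> ?R" "a \<in> words A" for K a
      using that H.subset by (auto simp: RCOSETS_def coset_mult_assoc)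
    have canc: "(K #>\<^bsub>?G\<^esub> a) #>\<^bsub>?G\<^esub> inv\<^bsub>?G\<^esub> a = K" "(K #>\<^bsub>?G\<^esub> inv\<^bsub>?G\<^esub> a) #>\<^bsub>?G\<^esub> a = K"
      if "K \<in> ?R" "a \<in> words A" for K a
    proof -
      have "K \<subseteq> words A" using that(1) rcosets_part_G[OF H] by auto
      then show "(K #>\<^bsub>?G\<^esub> a) #>\<^bsub>?G\<^esub> inv\<^bsub>?G\<^esub> a = K" "(K #>\<^bsub>?G\<^esub> inv\<^bsub>?G\<^esub> a) #>\<^bsub>?G\<^esub> a = K"
        using that(2) coset_mult_one[of K] by (simp_all add: coset_mult_assoc)
    qed
    have "[x] \<in> words A" using x by simp
    then show "bij_betw (\<lambda>K. K #>\<^bsub>?G\<^esub> [x]) ?R ?R"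
      by (intro bij_betw_byWitness[where f' = "\<lambda>K. K #>\<^bsub>?G\<^esub> inv\<^bsub>?G\<^esub> [x]"])
        (auto simp: canc in_R)
  qed
  have harm: "(\<Sum>y\<in>next_letters x. \<Phi> (K #>\<^bsub>?G\<^esub> [x]) y) = q * \<Phi> K x" if "K \<in> ?R" "x \<in> ?L" for K x
  proof -
    obtain g where g: "g \<in> words A" "K = H #>\<^bsub>?G\<^esub> g"
      using \<open>K \<in> ?R\<close> by (auto simp: RCOSETS_def)
    have "K #>\<^bsub>?G\<^esub> [x] = H #>\<^bsub>?G\<^esub> (g \<otimes>\<^bsub>?G\<^esub> [x])"
      using g that(2) H.subset by (simp add: coset_mult_assoc)
    then have "(\<Sum>y\<in>next_letters x. \<Phi> (K #>\<^bsub>?G\<^esub> [x]) y) = (\<Sum>y\<in>next_letters x. \<phi> (g \<otimes>\<^bsub>?G\<^esub> [x]) y)"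
      using g(1) that(2) succ(2)[of x] by (intro sum.cong) (auto simp: \<Phi>)
    then show ?thesis
      using harmonic[OF g(1) that(2)] g that(2) by (simp add: \<Phi> next_letters_def)
  qed
  define E where "E K x y = (\<Phi> K x - \<Phi> (K #>\<^bsub>?G\<^esub> [x]) y)\<^sup>2" for K x y
  have "(\<Sum>x\<in>?L. \<Sum>K\<in>?R. \<Sum>y\<in>next_letters x. E K x y) = 0"
  proof -
    \<comment> \<open>By harmonicity the cross term of the square is \<open>- 2 * q\<close> times
      the square of \<open>\<Phi> K x\<close>, and half of it cancels against the first
      term.\<close>
    have expand: "(\<Sum>y\<in>next_letters x. E K x y) =
        (\<Sum>y\<in>next_letters x. (\<Phi> (K #>\<^bsub>?G\<^esub> [x]) y)\<^sup>2) - q * (\<Phi> K x)\<^sup>2" if "K \<in> ?R" "x \<in> ?L" for K x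
    proof -
      have "(\<Sum>y\<in>next_letters x. E K x y) = (\<Sum>y\<in>next_letters x. (\<Phi> K x)\<^sup>2)
          + (\<Sum>y\<in>next_letters x. (\<Phi> (K #>\<^bsub>?G\<^esub> [x]) y)\<^sup>2)
          - 2 * \<Phi> K x * (\<Sum>y\<in>next_letters x. \<Phi> (K #>\<^bsub>?G\<^esub> [x]) y)"
        unfolding E_def by (simp add: power2_diff sum.distrib sum_subtractf sum_distrib_left)
      also have "(\<Sum>y\<in>next_letters x. (\<Phi> K x)\<^sup>2) = q * (\<Phi> K x)\<^sup>2"
        using card_next[OF that(2)] by simp
      also have "2 * \<Phi> K x * (\<Sum>y\<in>next_letters x. \<Phi> (K #>\<^bsub>?G\<^esub> [x]) y) = 2 * q * (\<Phi> K x)\<^sup>2"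
        by (simp add: harm[OF that] power2_eq_square)
      finally show ?thesis by simp
    qed
    have "(\<Sum>x\<in>?L. \<Sum>K\<in>?R. \<Sum>y\<in>next_letters x. E K x y) =
        (\<Sum>x\<in>?L. \<Sum>K\<in>?R. \<Sum>y\<in>next_letters x. (\<Phi> (K #>\<^bsub>?G\<^esub> [x]) y)\<^sup>2)
        - (\<Sum>x\<in>?L. \<Sum>K\<in>?R. q * (\<Phi> K x)\<^sup>2)"
      by (simp add: expand sum_subtractf)
    also have "(\<Sum>x\<in>?L. \<Sum>K\<in>?R. \<Sum>y\<in>next_letters x. (\<Phi> (K #>\<^bsub>?G\<^esub> [x]) y)\<^sup>2) =
        (\<Sum>x\<in>?L. \<Sum>y\<in>next_letters x. \<Sum>K\<in>?R. (\<Phi> K y)\<^sup>2)"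
    proof (rule sum.cong[OF refl])
      fix x assume x: "x \<in> ?L"
      show "(\<Sum>K\<in>?R. \<Sum>y\<in>next_letters x. (\<Phi> (K #>\<^bsub>?G\<^esub> [x]) y)\<^sup>2) =
          (\<Sum>y\<in>next_letters x. \<Sum>K\<in>?R. (\<Phi> K y)\<^sup>2)"
        by (subst sum.swap) (rule sum.cong[OF refl shift[OF x]])
    qed
    \<comment> \<open>\<open>y\<close> may follow \<open>x\<close> exactly when \<open>x\<close> may
      follow \<open>y\<close>, so each letter has as many predecessors as successors, namely
      \<open>q\<close>. With \<open>shift\<close> this is the double stochasticity.\<close>
    also have "\<dots> = (\<Sum>y\<in>?L. \<Sum>x\<in>next_letters y. \<Sum>K\<in>?R. (\<Phi> K y)\<^sup>2)"
    proof -
      have eq: "{x \<in> ?L. y \<in> next_letters x} = next_letters y" if "y \<in> ?L" for y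
        using that by (auto simp: next_letters_def)
      have "(\<Sum>x\<in>?L. \<Sum>y\<in>{y \<in> ?L. y \<in> next_letters x}. \<Sum>K\<in>?R. (\<Phi> K y)\<^sup>2) =
          (\<Sum>y\<in>?L. \<Sum>x\<in>{x \<in> ?L. y \<in> next_letters x}. \<Sum>K\<in>?R. (\<Phi> K y)\<^sup>2)"
        by (rule sum.swap_restrict[OF finite_letters finite_letters])
      moreover have "{y \<in> ?L. y \<in> next_letters x} = next_letters x" for x
        by (auto simp: next_letters_def)
      ultimately show ?thesis using eq by simp
    qed
    also have "\<dots> = (\<Sum>y\<in>?L. \<Sum>K\<in>?R. q * (\<Phi> K y)\<^sup>2)"
      by (simp add: card_next sum_distrib_left)
    finally show ?thesis by simp
  qed
  moreover have "E K x y \<ge> 0" for K x y by (simp add: E_def)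
  ultimately have E_0: "E K x y = 0" if "K \<in> ?R" "x \<in> ?L" "y \<in> next_letters x" for K x y
    using that fin finite_letters succ(1) by (simp add: sum_nonneg_eq_0_iff sum_nonneg)
  have step: "\<phi> g x = \<phi> (g \<otimes>\<^bsub>?G\<^esub> [x]) y"
    if "g \<in> words A" "x \<in> ?L" "y \<in> next_letters x" for g x y
  proof -
    have "H #>\<^bsub>?G\<^esub> g \<in> ?R" using that by (auto simp: RCOSETS_def)
    moreover have "(H #>\<^bsub>?G\<^esub> g) #>\<^bsub>?G\<^esub> [x] = H #>\<^bsub>?G\<^esub> (g \<otimes>\<^bsub>?G\<^esub> [x])"
      using that H.subset by (simp add: coset_mult_assoc)
    ultimately show ?thesis
      using E_0[of "H #>\<^bsub>?G\<^esub> g" x y] that succ(2)[of x]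
      by (auto simp: E_def \<Phi>)
  qed
  \<comment> \<open>There are at least four letters, so some \<open>x\<close> can precede both
    \<open>y\<close> and \<open>z\<close>; the value at the state before determines both.\<close>
  have letter: "\<phi> g y = \<phi> g z" if g: "g \<in> words A" and yz: "y \<in> ?L" "z \<in> ?L" for g y z
  proof -
    have "card {inv_letter y, inv_letter z} \<le> 2" by (simp add: card_insert_if)
    then have "card {inv_letter y, inv_letter z} < card ?L"
      using card_letters q_ge by linarith
    then have "\<not> ?L \<subseteq> {inv_letter y, inv_letter z}"
      using card_mono[of "{inv_letter y, inv_letter z}" ?L] by auto
    then obtain x where x: "x \<in> ?L" "x \<noteq> inv_letter y" "x \<noteq> inv_letter z" by auto
    let ?g = "g \<otimes>\<^bsub>?G\<^esub> inv\<^bsub>?G\<^esub> [x]"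
    have "?g \<in> words A" "?g \<otimes>\<^bsub>?G\<^esub> [x] = g"
      using g x by (auto simp: m_assoc)
    moreover have "y \<in> next_letters x" "z \<in> next_letters x"
      using x yz by (auto simp: next_letters_def)
    ultimately show ?thesis using step[of ?g x y] step[of ?g x z] x by simp
  qed
  obtain x0 where x0: "x0 \<in> ?L"
    using card_letters q_ge by (cases "?L = {}") auto
  \<comment> \<open>A letter may follow itself, so appending \<open>y\<close> to \<open>g\<close>
    keeps the value at \<open>y\<close>; \<open>letter\<close> then passes to any other
    letter.\<close>
  have "\<phi> g x = \<phi> [] x0" if "g \<in> words A" "x \<in> ?L" for g x
    using that
  proof (induction g arbitrary: x rule: rev_induct)
    case Nil
    then show ?case using letter[OF _ _ x0] by blast
  next
    case (snoc y g)
    have g: "g \<in> words A" and y: "y \<in> ?L"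
      using append_in_words1[OF snoc.prems(1)] append_in_words2[OF snoc.prems(1)] by auto
    have "y \<in> next_letters y" using y by (simp add: next_letters_def)
    then have "\<phi> g y = \<phi> (g @ [y]) y"
      using step[OF g y] mult_eq_append[OF snoc.prems(1)] by metis
    then show ?case
      using letter[OF snoc.prems(1,2) y] snoc.IH[OF g y] by metis
  qed
  then show thesis using that by blast
qed

section \<open>Subgroups of finite index\<close>

context uniform_boundary
begin

lemma ergodic_finite_index:
  assumes H: "subgroup H (free_group A)" and fin: "finite (rcosets\<^bsub>free_group A\<^esub> H)"
  shows "ergodic_action (free_group A\<lparr>carrier := H\<rparr>) boundary_act M"
  unfolding ergodic_action_def
proof (intro ballI impI)
  fix B assume B: "B \<in> sets M"
    and "\<forall>g\<in>carrier (free_group A\<lparr>carrier := H\<rparr>). boundary_act g ` B = B"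
  then have B_inv: "boundary_act h ` B = B" if "h \<in> H" for h
    using that by simp
  interpret group "free_group A" by (rule group_free_group)
  let ?G = "free_group A"
  interpret H: subgroup H ?G by (rule H)
  define V where "V g = {\<omega> \<in> boundary A. boundary_act g \<omega> \<in> B}" for g
  define \<phi> where "\<phi> g x = measure M (V g \<inter> cylinder A [x])" for g x
  have V: "V g \<in> sets M" if "g \<in> words A" for g
    unfolding V_def by (rule boundary_act_vimage_sets[OF that B])
  have V_mult: "V (h \<otimes>\<^bsub>?G\<^esub> g) = V g" if h: "h \<in> H" and g: "g \<in> words A" for h g
  proof -
    have "boundary_act h \<omega> \<in> B \<longleftrightarrow> \<omega> \<in> B" if "\<omega> \<in> boundary A" for \<omega>
      using B_inv[OF h] sets_subset[OF B] that inj_on_image_mem_iff[OF inj_on_boundary_act]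
        H.subset h by blast
    then show ?thesis
      using h g by (auto simp: V_def boundary_act_mult boundary_act_words)
  qed
  have harmonic: "q * \<phi> g x = (\<Sum>y\<in>letters A - {inv_letter x}. \<phi> (g \<otimes>\<^bsub>?G\<^esub> [x]) y)"
    if g: "g \<in> words A" and x: "x \<in> letters A" for g x
  proof -
    let ?g = "g \<otimes>\<^bsub>?G\<^esub> [x]"
    \<comment> \<open>\<open>C\<close> holds the rays of \<open>V ?g\<close> to which
      \<open>x\<close> can be prepended without cancellation. Prepending it gives the part of
      \<open>V g\<close> in the cylinder of \<open>x\<close> and divides the measure by
      \<open>q\<close>; splitting \<open>C\<close> by first letters gives the sum.\<close>
    define C where "C = V ?g \<inter> {\<omega> \<in> boundary A. \<omega> 0 \<noteq> inv_letter x}"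
    have gx: "?g \<in> words A" using g x by simp
    have C: "C \<in> sets M"
      unfolding C_def using V[OF gx] first_letter_sets[of "\<lambda>y. y \<noteq> inv_letter x"] by (rule sets.Int)
    have "cons_red_inf x ` C = V g \<inter> cylinder A [x]"
    proof (intro equalityI subsetI)
      fix \<eta> assume "\<eta> \<in> cons_red_inf x ` C"
      then obtain \<omega> where \<omega>: "\<omega> \<in> C" "\<eta> = cons_red_inf x \<omega>" by auto
      then have "boundary_act ?g \<omega> = boundary_act g \<eta>"
        using boundary_act_mult[of g A "[x]" \<omega>] g x by (simp add: C_def boundary_act_def)
      then show "\<eta> \<in> V g \<inter> cylinder A [x]"
        using \<omega> x cons_red_inf_boundary[of x A \<omega>]
        by (auto simp: C_def V_def cylinder_def cons_red_inf_def)
    next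
      fix \<eta> assume \<eta>: "\<eta> \<in> V g \<inter> cylinder A [x]"
      define \<omega> where "\<omega> = cons_red_inf (inv_letter x) \<eta>"
      have bd: "\<eta> \<in> boundary A" "\<eta> 0 = x"
        using \<eta> by (auto simp: cylinder_def)
      have \<omega>: "\<omega> \<in> boundary A" "\<eta> = cons_red_inf x \<omega>"
        using bd x cons_red_inf_boundary[of "inv_letter x" A \<eta>]
        by (simp_all add: \<omega>_def cons_red_inf_cancel')
      have "\<omega> 0 \<noteq> inv_letter x"
        using bd by (auto simp: \<omega>_def cons_red_inf_def boundary_def)
      moreover have "boundary_act ?g \<omega> = boundary_act g \<eta>"
        using boundary_act_mult[of g A "[x]" \<omega>] g x \<omega> by (simp add: boundary_act_def)
      ultimately have "\<omega> \<in> C" using \<omega>(1) \<eta> by (simp add: C_def V_def)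
      then show "\<eta> \<in> cons_red_inf x ` C" using \<omega>(2) by blast
    qed
    then have "\<phi> g x = measure M C / q"
      using measure_cons_red_inf[OF x C] by (simp add: \<phi>_def C_def)
    moreover have "measure M C = (\<Sum>y\<in>letters A. measure M (C \<inter> cylinder A [y]))"
      by (rule measure_first_letter[OF finite_measure_axioms refl C])
    moreover have "C \<inter> cylinder A [inv_letter x] = {}"
      by (auto simp: C_def cylinder_def)
    then have "(\<Sum>y\<in>letters A. measure M (C \<inter> cylinder A [y])) =
        (\<Sum>y\<in>letters A - {inv_letter x}. measure M (C \<inter> cylinder A [y]))"
      by (intro sum.mono_neutral_right[OF finite_letters]) auto
    moreover have "\<dots> = (\<Sum>y\<in>letters A - {inv_letter x}. \<phi> ?g y)"
      unfolding \<phi>_def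
      by (intro sum.cong arg_cong[of _ _ "measure M"]) (auto simp: C_def cylinder_def)
    ultimately show ?thesis using q_ge by simp
  qed
  obtain c where c: "\<And>g x. g \<in> words A \<Longrightarrow> x \<in> letters A \<Longrightarrow> \<phi> g x = c"
    by (rule harmonic_const[OF H fin _ harmonic]) (simp_all add: \<phi>_def V_mult)
  obtain x0 where x0: "x0 \<in> letters A"
    using card_letters q_ge by (cases "letters A = {}") auto
  have "c \<ge> 0" using c[OF Nil_in_words x0] by (auto simp: \<phi>_def)
  \<comment> \<open>Pulled back by \<open>g\<close>, the cylinder of \<open>g @ [x]\<close> becomes
    that of \<open>[x]\<close>, in which \<open>V g\<close> has measure \<open>c\<close>. As that
    cylinder has measure \<open>1 / (q + 1)\<close>, the density of \<open>B\<close> is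
    \<open>c * (q + 1)\<close> in every cylinder.\<close>
  have meas: "measure M (B \<inter> C) = c * (q + 1) * measure M C" if C: "C \<in> sets M" for C
  proof -
    have "measure (density M (indicator B)) C = c * (q + 1) * measure M C"
    proof (rule measure_eq_if_cylinders[OF _ _ finite_measure_axioms refl _ _ C])
      show "finite_measure (density M (indicator B))"
        by (rule finite_measure_restricted[OF B])
      fix w assume w: "w \<in> words A" "w \<noteq> []"
      then obtain g x where gx: "w = g @ [x]" by (cases w rule: rev_cases) auto
      have g: "g \<in> words A" and x: "x \<in> letters A"
        using w append_in_words1 append_in_words2[of g "[x]"] by (auto simp: gx)
      have "boundary_act g ` (V g \<inter> cylinder A [x]) = B \<inter> cylinder A w"
      proof -
        have "boundary_act g ` (V g \<inter> cylinder A [x]) = boundary_act g ` V g \<inter> boundary_act g ` cylinder A [x]"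
          using inj_on_boundary_act[OF g] cylinder_subset_boundary
          by (intro inj_on_image_Int) (auto simp: V_def)
        also have "boundary_act g ` V g = B"
        proof -
          have "V g = boundary_act (inv\<^bsub>?G\<^esub> g) ` B"
            using boundary_act_image[of "inv\<^bsub>?G\<^esub> g" A B] g sets_subset[OF B] by (simp add: V_def)
          then show ?thesis
            using sets_subset[OF B] g by (force simp: image_image boundary_act_inv subset_iff)
        qed
        also have "boundary_act g ` cylinder A [x] = cylinder A w"
          using boundary_act_cylinder[of g "[x]" A] w by (simp add: gx)
        finally show ?thesis .
      qed
      then have "measure M (B \<inter> cylinder A w) = \<phi> g x / q ^ length g"
        using measure_boundary_act[of g x "V g \<inter> cylinder A [x]"] w V[OF g]
        by (simp add: gx \<phi>_def)
      then have "measure M (B \<inter> cylinder A w) = c * (q + 1) * measure M (cylinder A w)"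
        using measure_cylinder[OF w] c[OF g x] q_ge by (simp add: gx)
      then show "measure (density M (indicator B)) (cylinder A w) = c * (q + 1) * measure M (cylinder A w)"
        using measure_restricted[OF B cylinder_sets] by simp
    qed (use \<open>c \<ge> 0\<close> q_ge in auto)
    then show ?thesis using measure_restricted[OF B C] by simp
  qed
  have compl: "space M - B \<in> sets M" using B by blast
  \<comment> \<open>For the complement of \<open>B\<close> the left-hand side of \<open>meas\<close>
    is zero.\<close>
  have "c = 0 \<or> measure M (space M - B) = 0"
    using meas[OF compl] q_ge by (auto simp: Int_Diff)
  moreover have "measure M B = 0" if "c = 0" using meas[OF B] that by simp
  ultimately show "B \<in> null_sets M \<or> space M - B \<in> null_sets M"
    using B compl by (auto simp: null_sets_def emeasure_eq_measure)
qed

section \<open>Conservativity of ergodic actions\<close>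

lemma exists_small_cylinder:
  assumes "C \<in> sets M" "measure M C > 0"
  shows "\<exists>w. measure M (C \<inter> cylinder A w) > 0 \<and> measure M (C - cylinder A w) > 0"
proof -
  \<comment> \<open>Cylinders of length \<open>n + 1\<close> have measure at most
    \<open>(1 / q) ^ n\<close>, so none contains almost all of \<open>C\<close>; finitely many of
    them cover \<open>C\<close>, so one meets it in positive measure.\<close>
  obtain n where n: "(1 / q) ^ n < measure M C"
    using real_arch_pow_inv[OF assms(2), of "1 / q"] q_ge by auto
  let ?W = "{w \<in> words A. length w = Suc n}"
  have "(\<Union>w\<in>?W. C \<inter> cylinder A w) = C"
    using sets_subset[OF assms(1)] by (auto simp: cylinder_iff prefix_in_words simp del: upt_Suc)
  moreover have "(\<lambda>w. C \<inter> cylinder A w) ` ?W \<subseteq> sets M"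
    using assms(1) by auto
  ultimately have "measure M C \<le> (\<Sum>w\<in>?W. measure M (C \<inter> cylinder A w))"
    using finite_measure_subadditive_finite[OF finite_words_length, of "\<lambda>w. C \<inter> cylinder A w" "Suc n"]
    by metis
  then have "\<not> (\<forall>w\<in>?W. measure M (C \<inter> cylinder A w) \<le> 0)"
    using assms(2) sum_nonpos[of ?W "\<lambda>w. measure M (C \<inter> cylinder A w)"] by fastforce
  then obtain w where w: "w \<in> words A" "length w = Suc n" "measure M (C \<inter> cylinder A w) > 0"
    by auto
  have "measure M (cylinder A w) \<le> (1 / q) ^ n"
  proof -
    have "q ^ n \<le> (q + 1) * q ^ n"
      using mult_right_mono[of 1 "q + 1" "q ^ n"] q_ge by simp
    then have "1 / ((q + 1) * q ^ n) \<le> 1 / q ^ n"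
      using q_ge by (intro divide_left_mono) auto
    then show ?thesis
      using measure_cylinder[OF w(1)] w(2) by (cases w) (auto simp: power_one_over)
  qed
  then have "measure M (C \<inter> cylinder A w) < measure M C"
    using finite_measure_mono[of "C \<inter> cylinder A w" "cylinder A w"] n by simp
  moreover have "measure M (C - cylinder A w) = measure M C - measure M (C \<inter> cylinder A w)"
    by (rule finite_measure_Diff') (use assms in auto)
  ultimately show ?thesis using w(3) by auto
qed

text \<open>A wandering set of positive measure could be split into two parts of positive measure, and
  the translates of one part would form an invariant set which is neither null nor conull.\<close>

lemma conservative_if_ergodic:
  assumes H: "subgroup H (free_group A)"
    and erg: "ergodic_action (free_group A\<lparr>carrier := H\<rparr>) boundary_act M"
  shows "conservative_action (free_group A\<lparr>carrier := H\<rparr>) boundary_act M"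
  unfolding conservative_action_def recurrent_set_def
proof (intro ballI impI conjI)
  fix B assume B: "B \<in> sets M"
  interpret group "free_group A" by (rule group_free_group)
  let ?G = "free_group A"
  interpret H: subgroup H ?G by (rule H)
  have count: "countable H" using countable_subset[OF H.subset countable_words] .
  have img: "boundary_act h ` C \<in> sets M" if "h \<in> H" "C \<in> sets M" for h C
    using that boundary_act_image_sets by simp
  \<comment> \<open>\<open>D\<close> is the non-recurrent part of \<open>B\<close>. It is disjoint
    from its translates by non-trivial elements, since these lie in translates of
    \<open>B\<close>.\<close>
  define D where "D = B - (\<Union>h\<in>H - {[]}. boundary_act h ` B)"
  have "(\<Union>h\<in>H - {[]}. boundary_act h ` B) \<in> sets M"
    using img[OF _ B] count by (intro sets.countable_UN'') auto
  then have D: "D \<in> sets M" using B by (simp add: D_def)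
  have "measure M D = 0"
  proof (rule ccontr)
    assume "measure M D \<noteq> 0"
    then have "measure M D > 0" using measure_nonneg[of M D] by linarith
    then obtain w where w: "measure M (D \<inter> cylinder A w) > 0" "measure M (D - cylinder A w) > 0"
      using exists_small_cylinder[OF D] by blast
    define U where "U = (\<Union>h\<in>H. boundary_act h ` (D \<inter> cylinder A w))"
    have D': "D \<inter> cylinder A w \<in> sets M" using D by simp
    have U: "U \<in> sets M"
      unfolding U_def using img[OF _ D'] by (rule sets.countable_UN''[OF count])
    have mult: "boundary_act g (boundary_act h \<omega>) = boundary_act (g \<otimes>\<^bsub>?G\<^esub> h) \<omega>"
      if "g \<in> H" "h \<in> H" "\<omega> \<in> D" for g h \<omega>
      using that sets_subset[OF D] boundary_act_mult[of g A h \<omega>] by auto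
    have U_inv: "boundary_act g ` U = U" if g: "g \<in> H" for g
    proof (intro equalityI subsetI)
      fix \<eta> assume "\<eta> \<in> boundary_act g ` U"
      then obtain h \<omega> where "h \<in> H" "\<omega> \<in> D \<inter> cylinder A w" "\<eta> = boundary_act g (boundary_act h \<omega>)"
        by (auto simp: U_def)
      then show "\<eta> \<in> U" using mult g unfolding U_def
        by (intro UN_I[of "g \<otimes>\<^bsub>?G\<^esub> h"]) auto
    next
      fix \<eta> assume "\<eta> \<in> U"
      then obtain h \<omega> where h\<omega>: "h \<in> H" "\<omega> \<in> D \<inter> cylinder A w" "\<eta> = boundary_act h \<omega>"
        by (auto simp: U_def)
      let ?h = "inv\<^bsub>?G\<^esub> g \<otimes>\<^bsub>?G\<^esub> h"
      have "?h \<in> H" using h\<omega> g by simp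
      moreover have "\<eta> = boundary_act g (boundary_act ?h \<omega>)"
        using mult[OF g \<open>?h \<in> H\<close>] h\<omega> g by (simp add: mult_inv_cancel)
      ultimately show "\<eta> \<in> boundary_act g ` U"
        unfolding U_def using h\<omega> by blast
    qed
    have "U \<in> null_sets M \<or> space M - U \<in> null_sets M"
      by (rule erg[unfolded ergodic_action_def, rule_format, OF U]) (simp add: U_inv)
    then consider "U \<in> null_sets M" | "space M - U \<in> null_sets M" by blast
    then show False
    proof cases
      case 1
      have "D \<inter> cylinder A w \<subseteq> U"
        unfolding U_def using H.one_closed by (force intro!: UN_I[of "[]"])
      then have "measure M (D \<inter> cylinder A w) \<le> measure M U"
        using U by (rule finite_measure_mono)
      then show False using 1 w by (simp add: null_sets_def measure_def)
    next
      case 2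
      have "(D - cylinder A w) \<inter> boundary_act h ` (D \<inter> cylinder A w) = {}" if "h \<in> H" for h
        using that by (cases "h = []") (auto simp: D_def)
      then have "D - cylinder A w \<subseteq> space M - U"
        using sets_subset[OF D] by (auto simp: U_def)
      then have "measure M (D - cylinder A w) \<le> measure M (space M - U)"
        by (rule finite_measure_mono[OF _ sets.compl_sets[OF U]])
      then show False using 2 w by (simp add: null_sets_def measure_def)
    qed
  qed
  then have "D \<in> null_sets M" using D by (auto simp: null_sets_def emeasure_eq_measure)
  then show "AE x in M. x \<in> B \<longrightarrow> x \<in> (\<Union>g\<in>carrier (?G\<lparr>carrier := H\<rparr>) - {\<one>\<^bsub>?G\<lparr>carrier := H\<rparr>\<^esub>}. boundary_act g ` B)"
    by (rule AE_I') (auto simp: D_def)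
qed

section \<open>Finitely generated subgroups of infinite index\<close>

text \<open>Below each non-empty vertex of \<open>T\<close> a subcylinder of relative measure
  \<open>(1 / q) ^ L\<close> leaves \<open>T\<close>. So every \<open>L\<close> levels the rays
  still in \<open>T\<close> lose at least a fixed proportion of their measure, which decays
  geometrically.\<close>

lemma limit_set_null:
  assumes closed: "\<And>u v. u @ v \<in> T \<Longrightarrow> u \<in> T"
    and escape: "\<forall>t\<in>words A. t \<noteq> [] \<longrightarrow> (\<exists>v. length v = L \<and> t @ v \<in> words A \<and> t @ v \<notin> T)"
  shows "AE \<omega> in M. \<exists>n. prefix \<omega> n \<notin> T"
proof -
  define \<Lambda> where "\<Lambda> n = {\<omega> \<in> boundary A. prefix \<omega> n \<in> T}" for n
  have \<Lambda>: "\<Lambda> n \<in> sets M" for n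
    unfolding \<Lambda>_def by (rule prefix_sets)
  let ?r = "1 - (1 / q) ^ L"
  have r: "0 \<le> ?r" "?r < 1"
    using q_ge by (auto intro!: power_le_one)
  have contract: "measure M (\<Lambda> (n + L)) \<le> ?r * measure M (\<Lambda> n)" if "n \<noteq> 0" for n
  proof -
    let ?W = "{t \<in> words A. length t = n} \<inter> T"
    have fin: "finite ?W" using finite_words_length by simp
    have "\<forall>t\<in>?W. \<exists>v. length v = L \<and> t @ v \<in> words A \<and> t @ v \<notin> T"
      using escape \<open>n \<noteq> 0\<close> by auto
    from bchoice[OF this]
    obtain v where v: "\<And>t. t \<in> ?W \<Longrightarrow> length (v t) = L" "\<And>t. t \<in> ?W \<Longrightarrow> t @ v t \<in> words A"
      "\<And>t. t \<in> ?W \<Longrightarrow> t @ v t \<notin> T"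
      by blast
    have cyl: "measure M (cylinder A t - cylinder A (t @ v t)) = ?r * measure M (cylinder A t)"
      if "t \<in> ?W" for t
    proof -
      have t: "t \<in> words A" "t \<noteq> []" "length t = n" using that \<open>n \<noteq> 0\<close> by auto
      have "cylinder A (t @ v t) \<subseteq> cylinder A t"
        by (auto simp: cylinder_def nth_append)
      then have "measure M (cylinder A t - cylinder A (t @ v t)) =
          measure M (cylinder A t) - measure M (cylinder A (t @ v t))"
        by (intro finite_measure_Diff) auto
      moreover have "n + L - 1 = (n - 1) + L" using \<open>n \<noteq> 0\<close> by simp
      then have "measure M (cylinder A (t @ v t)) = (1 / q) ^ L * measure M (cylinder A t)"
        using measure_cylinder[OF t(1,2)] measure_cylinder[OF v(2)[OF that]] v(1)[OF that] t q_ge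
        by (simp add: power_add power_one_over)
      ultimately show ?thesis by (simp add: algebra_simps)
    qed
    have "\<Lambda> (n + L) \<subseteq> (\<Union>t\<in>?W. cylinder A t - cylinder A (t @ v t))"
    proof
      fix \<omega> assume \<omega>: "\<omega> \<in> \<Lambda> (n + L)"
      let ?t = "prefix \<omega> n"
      have "prefix \<omega> (n + L) = ?t @ map \<omega> [n..<n + L]"
        using upt_add_eq_append[of 0 n L] by simp
      then have t: "?t \<in> ?W"
        using \<omega> closed[of ?t] by (auto simp: \<Lambda>_def prefix_in_words)
      have "\<omega> \<notin> cylinder A (?t @ v ?t)"
        using v(1,3)[OF t] \<omega> by (auto simp: cylinder_iff \<Lambda>_def)
      moreover have "\<omega> \<in> cylinder A ?t" using \<omega> by (simp add: cylinder_iff \<Lambda>_def)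
      ultimately show "\<omega> \<in> (\<Union>t\<in>?W. cylinder A t - cylinder A (t @ v t))" using t by blast
    qed
    then have "measure M (\<Lambda> (n + L)) \<le> measure M (\<Union>t\<in>?W. cylinder A t - cylinder A (t @ v t))"
      using fin by (intro finite_measure_mono sets.finite_UN) auto
    also have "\<dots> \<le> (\<Sum>t\<in>?W. measure M (cylinder A t - cylinder A (t @ v t)))"
      using fin by (intro finite_measure_subadditive_finite) auto
    also have "\<dots> = ?r * (\<Sum>t\<in>?W. measure M (cylinder A t))"
      by (simp add: cyl sum_distrib_left)
    also have "(\<Sum>t\<in>?W. measure M (cylinder A t)) = measure M (\<Union>t\<in>?W. cylinder A t)"
      using fin by (intro finite_measure_finite_Union[symmetric])
        (auto simp: disjoint_family_on_def cylinder_iff)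
    also have "(\<Union>t\<in>?W. cylinder A t) = \<Lambda> n"
      by (auto simp: \<Lambda>_def cylinder_iff prefix_in_words)
    finally show ?thesis .
  qed
  \<comment> \<open>The count starts at level 1 because \<open>contract\<close> excludes the root,
    whose cylinder splits into \<open>q + 1\<close> parts instead of \<open>q\<close>.\<close>
  have bound: "measure M (\<Lambda> (1 + k * L)) \<le> ?r ^ k" for k
  proof (induction k)
    case (Suc k)
    have "measure M (\<Lambda> (1 + k * L + L)) \<le> ?r * measure M (\<Lambda> (1 + k * L))"
      by (rule contract) simp
    also have "\<dots> \<le> ?r * ?r ^ k" using Suc r by (intro mult_left_mono) auto
    finally show ?case by (simp add: add_ac)
  qed simp
  define limit_set where "limit_set = (\<Inter>n. \<Lambda> n)"
  have sets: "limit_set \<in> sets M" unfolding limit_set_def using \<Lambda> by blast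
  have "measure M limit_set \<le> ?r ^ k" for k
  proof -
    have "measure M limit_set \<le> measure M (\<Lambda> (1 + k * L))"
      by (rule finite_measure_mono[OF _ \<Lambda>]) (auto simp: limit_set_def)
    then show ?thesis using bound[of k] by simp
  qed
  then have "measure M limit_set \<le> 0"
    using LIMSEQ_power_zero[of ?r] r by (intro LIMSEQ_le_const[of "\<lambda>k. ?r ^ k"]) auto
  then have "limit_set \<in> null_sets M"
    using sets measure_nonneg[of M limit_set] by (auto simp: null_sets_def emeasure_eq_measure)
  then show ?thesis
    by (rule AE_I') (auto simp: limit_set_def \<Lambda>_def)
qed

lemma completely_dissipative_infinite_index:
  assumes fg: "finitely_generated_subgroup H (free_group A)"
    and inf: "infinite (rcosets\<^bsub>free_group A\<^esub> H)"
  shows "completely_dissipative_action (free_group A\<lparr>carrier := H\<rparr>) boundary_act M"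
proof -
  interpret group "free_group A" by (rule group_free_group)
  let ?G = "free_group A"
  obtain T P where P: "finite P" "P \<subseteq> words A" and tree: "invariant_tree A H T"
    and T_eq: "T = {h \<otimes>\<^bsub>?G\<^esub> p |h p. h \<in> H \<and> p \<in> P}"
    by (rule finitely_generated_hull[OF fg])
  interpret T: invariant_tree A H T by (rule tree)
  interpret H: subgroup H ?G by (rule T.subgroup)
  obtain L where L: "\<forall>t\<in>words A. t \<noteq> [] \<longrightarrow> (\<exists>v. length v = L \<and> t @ v \<in> words A \<and> t @ v \<notin> T)"
    by (rule infinite_index_escape[OF tree T_eq P inf])
  have null: "AE \<omega> in M. \<exists>n. prefix \<omega> n \<notin> T"
    using limit_set_null[OF T.prefix_in_tree L] .
  \<comment> \<open>The orbit of a vertex under left multiplication by \<open>H\<close> is its right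
    coset, and \<open>rep\<close> depends on the coset alone; the vertices with
    \<open>rep t = t\<close> form a transversal of the orbits.\<close>
  define rep where "rep t = (SOME u. u \<in> H #>\<^bsub>?G\<^esub> t)" for t
  have rep: "rep t \<in> H #>\<^bsub>?G\<^esub> t" if "t \<in> words A" for t
    unfolding rep_def using rcos_self[OF that T.subgroup] by (rule someI)
  have rep_mult: "rep (h \<otimes>\<^bsub>?G\<^esub> t) = rep t" if "h \<in> H" "t \<in> words A" for h t
  proof -
    have "h \<otimes>\<^bsub>?G\<^esub> t \<in> H #>\<^bsub>?G\<^esub> t" using that by (auto simp: r_coset_def)
    then have "H #>\<^bsub>?G\<^esub> t = H #>\<^bsub>?G\<^esub> (h \<otimes>\<^bsub>?G\<^esub> t)"
      using that T.subgroup by (intro repr_independence) auto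
    then show ?thesis by (simp add: rep_def)
  qed
  define B where "B = {\<omega> \<in> boundary A. \<exists>t. exits A T t \<omega> \<and> rep t = t}"
  \<comment> \<open>For a fixed vertex, the exit condition concerns a single prefix, one letter
    longer than the vertex, and there are countably many vertices.\<close>
  have "B = (\<Union>t\<in>{t \<in> T. rep t = t}. {\<omega> \<in> boundary A. prefix \<omega> (Suc (length t)) \<notin> T
      \<and> take (length t) (prefix \<omega> (Suc (length t))) = t})"
    by (auto simp: B_def T.exits_iff take_prefix simp del: upt_Suc)
  also have "\<dots> \<in> sets M"
  proof (rule sets.countable_UN'')
    show "countable {t \<in> T. rep t = t}"
      using countable_subset[OF T.tree_words countable_words] by (rule countable_subset[rotated]) auto
  qed (rule prefix_sets)
  finally have B: "B \<in> sets M" .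
  have "boundary_act g ` B \<inter> boundary_act h ` B = {}" if gh: "g \<in> H" "h \<in> H" "g \<noteq> h" for g h
  proof (rule ccontr)
    assume "\<not> ?thesis"
    then obtain \<omega> \<eta> where eq: "\<omega> \<in> B" "\<eta> \<in> B" "boundary_act g \<omega> = boundary_act h \<eta>" by blast
    then obtain t u where tu: "exits A T t \<omega>" "rep t = t" "exits A T u \<eta>" "rep u = u"
      by (auto simp: B_def)
    have bd: "\<omega> \<in> boundary A" "\<eta> \<in> boundary A" using eq by (auto simp: B_def)
    have w: "t \<in> words A" "u \<in> words A"
      using tu T.tree_words by (auto simp: exits_def)
    \<comment> \<open>Both products are exit vertices of the same ray. They lie in the orbits of
      \<open>t\<close> and \<open>u\<close>, so these representatives agree, and cancelling them
      gives \<open>g = h\<close>.\<close>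
    have "g \<otimes>\<^bsub>?G\<^esub> t = h \<otimes>\<^bsub>?G\<^esub> u"
      using T.exits_unique[of "boundary_act g \<omega>"] T.exits_mult[OF gh(1) bd(1) tu(1)]
        T.exits_mult[OF gh(2) bd(2) tu(3)] eq(3) boundary_act_words[of g A \<omega>] gh(1) bd(1)
      by simp
    moreover from this have "t = u" using rep_mult[OF gh(1) w(1)] rep_mult[OF gh(2) w(2)] tu by simp
    ultimately show False using gh w by simp
  qed
  then have wandering: "wandering_set (?G\<lparr>carrier := H\<rparr>) boundary_act M B"
    using B by (auto simp: wandering_set_def disjoint_family_on_def)
  have "\<omega> \<in> (\<Union>h\<in>H. boundary_act h ` B)" if \<omega>: "\<omega> \<in> boundary A" and n: "prefix \<omega> n \<notin> T" for \<omega> n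
  proof -
    obtain t where t: "exits A T t \<omega>" using T.exits_exist[OF \<omega> n] by blast
    have w: "t \<in> words A" using t T.tree_words by (auto simp: exits_def)
    \<comment> \<open>The element taking the exit vertex to its representative takes the ray into
      \<open>B\<close>.\<close>
    obtain h where h: "h \<in> H" "rep t = h \<otimes>\<^bsub>?G\<^esub> t"
      using rep[OF w] by (auto simp: r_coset_def)
    have "boundary_act h \<omega> \<in> B"
      using T.exits_mult[OF h(1) \<omega> t] h rep_mult[OF h(1) w] boundary_act_words[of h A \<omega>] \<omega>
      by (auto simp: B_def)
    moreover have "\<omega> = boundary_act (inv\<^bsub>?G\<^esub> h) (boundary_act h \<omega>)"
      using h \<omega> by (simp add: boundary_act_inv)
    ultimately show ?thesis using h H.m_inv_closed by blast
  qed
  then have "AE \<omega> in M. (\<exists>n. prefix \<omega> n \<notin> T) \<longrightarrow> \<omega> \<in> (\<Union>h\<in>H. boundary_act h ` B)"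
    by (intro AE_I2) auto
  with null have "AE \<omega> in M. \<omega> \<in> (\<Union>h\<in>H. boundary_act h ` B)"
    by (rule AE_mp)
  then show ?thesis
    using wandering by (auto simp: completely_dissipative_action_def)
qed

end

theorem theorem3p30:
  fixes A :: "'a set" and H :: "'a letter list set" and M :: "(nat \<Rightarrow> 'a letter) measure"
  assumes "finite A" and "card A \<ge> 2"
    and "is_uniform_measure A M"
    and "finitely_generated_subgroup H (free_group A)"
    and "H \<noteq> {\<one>\<^bsub>free_group A\<^esub>}"
  shows "(finite (rcosets\<^bsub>free_group A\<^esub> H) \<and>
          ergodic_action (free_group A\<lparr>carrier := H\<rparr>) boundary_act M \<and>
          conservative_action (free_group A\<lparr>carrier := H\<rparr>) boundary_act M) \<or>
         (infinite (rcosets\<^bsub>free_group A\<^esub> H) \<and>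
          completely_dissipative_action (free_group A\<lparr>carrier := H\<rparr>) boundary_act M)"
proof -
  interpret uniform_boundary A M
    using assms(1-3) by unfold_locales
  have H: "subgroup H (free_group A)"
    using assms(4) by (simp add: finitely_generated_subgroup_def)
  show ?thesis
  proof (cases "finite (rcosets\<^bsub>free_group A\<^esub> H)")
    case True
    then show ?thesis
      using ergodic_finite_index[OF H] conservative_if_ergodic[OF H] by simp
  next
    case False
    then show ?thesis using completely_dissipative_infinite_index[OF assms(4)] by simp
  qed
qed

end
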